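(* Let $k\ge2$ and let $G$ be a connected $\mathcal{C}_k$-symmetric graph with a countably infinite vertex set. Then $G$ has a $\mathcal{C}_k$-symmetric NAC-coloring if and only if $G$ has a $\mathcal{C}_k$-symmetric realization $\rho$ in $\mathbb{R}^2$ such that $(G,\rho)$ is $\mathcal{C}_k$-symmetric flexible.
   Context: Let $\mathcal{C}_k=\langle\omega:\omega^k=1\rangle$ act on $G$ via an injective homomorphism $\theta\colon\mathcal{C}_k\to\mathrm{Aut}(G)$; write $\gamma v=\theta(\gamma)(v)$, $\gamma(uv)=(\gamma u)(\gamma v)$. A vertex is invariant if fixed by all $\gamma$, partially invariant if fixed by some $\gamma\neq1$. $G$ is $\mathcal{C}_k$-symmetric if every partially invariant vertex is invariant and the invariant vertices form an independent set. A realization $\rho\colon V_G\to\mathbb{R}^2$ (adjacent vertices mapped to distinct points) is $\mathcal{C}_k$-symmetric if $\rho(\omega^jv)=\tau(\omega^j)\rho(v)$ for all $v,j$, where $\tau(\omega^j)$ is the clockwise rotation by $2j\pi/k$. A flex is a path $t\mapsto\rho_t$, $t\in[0,\varepsilon)$, of realizations with each $t\mapsto\rho_t(v)$ continuous, $\rho_0=\rho$ and edge lengths constant; trivial if every $\rho_t$ is congruent to $\rho$ via a Euclidean isometry. $(G,\rho)$ is $\mathcal{C}_k$-symmetric flexible if it has a non-trivial flex with every $\rho_t$ $\mathcal{C}_k$-symmetric. A NAC-coloring is a surjective $\delta\colon E_G\to\{\text{red},\text{blue}\}$ such that every (finite) cycle is monochromatic or contains at least two edges of each color. Red (resp. blue)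 components are connected components of the spanning subgraph of red (resp. blue) edges; a component $H$ is partially invariant if $\gamma H=H$ for some $\gamma\neq1$. $\delta$ is $\mathcal{C}_k$-symmetric if $\delta(\gamma e)=\delta(e)$ for all $e,\gamma$ and no two distinct red partially invariant components, and no two distinct blue partially invariant components, are joined by an edge. *)

theory Defs
  imports "HOL-Analysis.Analysis" "HOL-Algebra.Bij" "HOL-Algebra.Elementary_Groups"
begin

section \<open>Graphs and cyclic group actions\<close>

definition simple_graph :: "'v set \<Rightarrow> 'v set set \<Rightarrow> bool" where
  "simple_graph V E \<longleftrightarrow> E \<subseteq> {e. e \<subseteq> V \<and> card e = 2}"

definition reachable :: "'v set set \<Rightarrow> ('v \<times> 'v) set" where
  "reachable F = {(u, v). {u, v} \<in> F}\<^sup>*"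

definition connected_graph :: "'v set \<Rightarrow> 'v set set \<Rightarrow> bool" where
  "connected_graph V E \<longleftrightarrow> (\<forall>u\<in>V. \<forall>v\<in>V. (u, v) \<in> reachable E)"

text \<open>The components of the spanning subgraph \<open>(V, F)\<close>, each represented by its vertex set;
  an isolated vertex forms a component.\<close>

definition components_of_graph :: "'v set \<Rightarrow> 'v set set \<Rightarrow> 'v set set" where
  "components_of_graph V F = {{w \<in> V. (v, w) \<in> reachable F} | v. v \<in> V}"

definition graph_aut_group :: "'v set \<Rightarrow> 'v set set \<Rightarrow> ('v \<Rightarrow> 'v) monoid" where
  "graph_aut_group V E = BijGroup V
     \<lparr>carrier := {f \<in> Bij V. \<forall>u\<in>V. \<forall>v\<in>V. {f u, f v} \<in> E \<longleftrightarrow> {u, v} \<in> E}\<rparr>"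

text \<open>The group \<open>\<langle>\<omega> : \<omega>\<^sup>k = 1\<rangle>\<close> is written additively as the integers modulo \<open>k\<close>: the element
  \<open>j \<in> {0..<k}\<close> stands for \<open>\<omega>\<^sup>j\<close>, and the identity is \<open>0\<close>.\<close>

abbreviation cyclic :: "nat \<Rightarrow> int monoid" where
  "cyclic k \<equiv> integer_mod_group k"

definition acts_on_graph ::
    "nat \<Rightarrow> (int \<Rightarrow> 'v \<Rightarrow> 'v) \<Rightarrow> 'v set \<Rightarrow> 'v set set \<Rightarrow> bool" where
  "acts_on_graph k \<theta> V E \<longleftrightarrow>
     \<theta> \<in> hom (cyclic k) (graph_aut_group V E) \<and> inj_on \<theta> (carrier (cyclic k))"

definition invariant_vertex :: "nat \<Rightarrow> (int \<Rightarrow> 'v \<Rightarrow> 'v) \<Rightarrow> 'v \<Rightarrow> bool" where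
  "invariant_vertex k \<theta> v \<longleftrightarrow> (\<forall>\<gamma> \<in> carrier (cyclic k). \<theta> \<gamma> v = v)"

definition partially_invariant_vertex :: "nat \<Rightarrow> (int \<Rightarrow> 'v \<Rightarrow> 'v) \<Rightarrow> 'v \<Rightarrow> bool" where
  "partially_invariant_vertex k \<theta> v \<longleftrightarrow>
     (\<exists>\<gamma> \<in> carrier (cyclic k). \<gamma> \<noteq> \<one>\<^bsub>cyclic k\<^esub> \<and> \<theta> \<gamma> v = v)"

definition symmetric_graph ::
    "nat \<Rightarrow> (int \<Rightarrow> 'v \<Rightarrow> 'v) \<Rightarrow> 'v set \<Rightarrow> 'v set set \<Rightarrow> bool" where
  "symmetric_graph k \<theta> V E \<longleftrightarrow>
     simple_graph V E \<and> acts_on_graph k \<theta> V E \<and>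
     (\<forall>v\<in>V. partially_invariant_vertex k \<theta> v \<longrightarrow> invariant_vertex k \<theta> v) \<and>
     (\<forall>u\<in>V. \<forall>v\<in>V. invariant_vertex k \<theta> u \<and> invariant_vertex k \<theta> v \<longrightarrow> {u, v} \<notin> E)"


section \<open>Realizations and flexes\<close>

text \<open>A realization is a function on the whole vertex type of which only the values on the vertex
  set matter.\<close>

definition realization :: "'v set set \<Rightarrow> ('v \<Rightarrow> real^2) \<Rightarrow> bool" where
  "realization E \<rho> \<longleftrightarrow> (\<forall>u v. {u, v} \<in> E \<longrightarrow> \<rho> u \<noteq> \<rho> v)"

definition rotate_clockwise :: "real \<Rightarrow> real^2 \<Rightarrow> real^2" where
  "rotate_clockwise a p = vector [vector [cos a, sin a], vector [- sin a, cos a]] *v p"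

definition symmetric_realization ::
    "nat \<Rightarrow> (int \<Rightarrow> 'v \<Rightarrow> 'v) \<Rightarrow> 'v set \<Rightarrow> 'v set set \<Rightarrow> ('v \<Rightarrow> real^2) \<Rightarrow> bool" where
  "symmetric_realization k \<theta> V E \<rho> \<longleftrightarrow>
     realization E \<rho> \<and>
     (\<forall>j \<in> carrier (cyclic k). \<forall>v\<in>V.
        \<rho> (\<theta> j v) = rotate_clockwise (2 * real_of_int j * pi / real k) (\<rho> v))"

definition congruent_realizations ::
    "'v set \<Rightarrow> ('v \<Rightarrow> real^2) \<Rightarrow> ('v \<Rightarrow> real^2) \<Rightarrow> bool" where
  "congruent_realizations V \<rho> \<sigma> \<longleftrightarrow>
     (\<exists>f. (\<forall>x y. dist (f x) (f y) = dist x y) \<and> (\<forall>v\<in>V. \<sigma> v = f (\<rho> v)))"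

definition is_flex ::
    "'v set \<Rightarrow> 'v set set \<Rightarrow> ('v \<Rightarrow> real^2) \<Rightarrow> real \<Rightarrow> (real \<Rightarrow> 'v \<Rightarrow> real^2) \<Rightarrow> bool" where
  "is_flex V E \<rho> \<epsilon> \<rho>t \<longleftrightarrow>
     0 < \<epsilon> \<and>
     (\<forall>t\<in>{0..<\<epsilon>}. realization E (\<rho>t t)) \<and>
     (\<forall>v\<in>V. continuous_on {0..<\<epsilon>} (\<lambda>t. \<rho>t t v)) \<and>
     (\<forall>v\<in>V. \<rho>t 0 v = \<rho> v) \<and>
     (\<forall>t\<in>{0..<\<epsilon>}. \<forall>u v. {u, v} \<in> E \<longrightarrow> dist (\<rho>t t u) (\<rho>t t v) = dist (\<rho> u) (\<rho> v))"

definition trivial_flex ::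
    "'v set \<Rightarrow> ('v \<Rightarrow> real^2) \<Rightarrow> real \<Rightarrow> (real \<Rightarrow> 'v \<Rightarrow> real^2) \<Rightarrow> bool" where
  "trivial_flex V \<rho> \<epsilon> \<rho>t \<longleftrightarrow> (\<forall>t\<in>{0..<\<epsilon>}. congruent_realizations V \<rho> (\<rho>t t))"

definition symmetric_flexible ::
    "nat \<Rightarrow> (int \<Rightarrow> 'v \<Rightarrow> 'v) \<Rightarrow> 'v set \<Rightarrow> 'v set set \<Rightarrow> ('v \<Rightarrow> real^2) \<Rightarrow> bool" where
  "symmetric_flexible k \<theta> V E \<rho> \<longleftrightarrow>
     (\<exists>\<epsilon> \<rho>t. is_flex V E \<rho> \<epsilon> \<rho>t \<and> \<not> trivial_flex V \<rho> \<epsilon> \<rho>t \<and>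
        (\<forall>t\<in>{0..<\<epsilon>}. symmetric_realization k \<theta> V E (\<rho>t t)))"


section \<open>NAC-colorings\<close>

datatype color = Red | Blue

text \<open>A cycle is given by the list of its vertices; the indices are read cyclically.\<close>

definition cycle_edges :: "'v list \<Rightarrow> 'v set set" where
  "cycle_edges vs = {{vs ! i, vs ! (Suc i mod length vs)} | i. i < length vs}"

definition is_cycle :: "'v set set \<Rightarrow> 'v list \<Rightarrow> bool" where
  "is_cycle E vs \<longleftrightarrow> 3 \<le> length vs \<and> distinct vs \<and> cycle_edges vs \<subseteq> E"

definition NAC_coloring :: "'v set set \<Rightarrow> ('v set \<Rightarrow> color) \<Rightarrow> bool" where
  "NAC_coloring E \<delta> \<longleftrightarrow>
     \<delta> ` E = {Red, Blue} \<and>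
     (\<forall>vs. is_cycle E vs \<longrightarrow>
        (\<exists>c. \<forall>e \<in> cycle_edges vs. \<delta> e = c) \<or>
        (\<forall>c. 2 \<le> card {e \<in> cycle_edges vs. \<delta> e = c}))"

definition color_components ::
    "'v set \<Rightarrow> 'v set set \<Rightarrow> ('v set \<Rightarrow> color) \<Rightarrow> color \<Rightarrow> 'v set set" where
  "color_components V E \<delta> c = components_of_graph V {e \<in> E. \<delta> e = c}"

text \<open>For a coloring preserved by the action (the only case in which this is used), the action
  permutes the monochromatic components, so \<open>\<gamma>H = H\<close> may be tested on vertex sets.\<close>

definition partially_invariant_component ::
    "nat \<Rightarrow> (int \<Rightarrow> 'v \<Rightarrow> 'v) \<Rightarrow> 'v set \<Rightarrow> bool" where
  "partially_invariant_component k \<theta> H \<longleftrightarrow>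
     (\<exists>\<gamma> \<in> carrier (cyclic k). \<gamma> \<noteq> \<one>\<^bsub>cyclic k\<^esub> \<and> \<theta> \<gamma> ` H = H)"

definition symmetric_NAC_coloring ::
    "nat \<Rightarrow> (int \<Rightarrow> 'v \<Rightarrow> 'v) \<Rightarrow> 'v set \<Rightarrow> 'v set set \<Rightarrow> ('v set \<Rightarrow> color) \<Rightarrow> bool" where
  "symmetric_NAC_coloring k \<theta> V E \<delta> \<longleftrightarrow>
     NAC_coloring E \<delta> \<and>
     (\<forall>\<gamma> \<in> carrier (cyclic k). \<forall>e\<in>E. \<delta> (\<theta> \<gamma> ` e) = \<delta> e) \<and>
     (\<forall>c. \<forall>H \<in> color_components V E \<delta> c. \<forall>H' \<in> color_components V E \<delta> c.
        H \<noteq> H' \<and> partially_invariant_component k \<theta> H \<and> partially_invariant_component k \<theta> H' \<longrightarrow>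
        \<not> (\<exists>u\<in>H. \<exists>v\<in>H'. {u, v} \<in> E))"

end

theory Submission
  imports Defs "HOL-Library.Function_Algebras"
begin

text \<open>
  From a flex to a coloring: identify the plane with the complex numbers and let \<open>w v\<close> be the position
  of the vertex \<open>v\<close> as a function of time. Relative to a fixed edge \<open>W0\<close>, some ratio \<open>W1 / W0\<close> of
  edge vectors is not constant, hence takes infinitely many values and is transcendental over the
  constants. By Zorn's lemma it lies in a maximal non-unital algebra \<open>S\<close> of complex-valued functions
  that omits \<open>1\<close>. Such an \<open>S\<close> behaves like the maximal ideal of a valuation ring: a unit outside \<open>S\<close>
  has an inverse that preserves \<open>S\<close>. Coloring an edge red iff \<open>W / W0 \<in> S\<close> gives the NAC-coloring,
  because \<open>W * cnj W\<close> is constant on each edge. The symmetry conditions hold since the action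
  multiplies positions by constants and \<open>w (\<theta> j v) - w v\<close> is a nonzero multiple of \<open>w v\<close>.

  From a coloring to a flex: label red components by \<open>a\<close> and blue components by \<open>b\<close>, equivariantly and
  injectively except that all partially invariant components are sent to \<open>0\<close>, and let \<open>v\<close>
  move as \<open>cis t * a v + b v\<close>.
\<close>

section \<open>Maximal proper subalgebras\<close>

definition subring_of :: "'a::comm_ring_1 set \<Rightarrow> bool" where
  "subring_of C \<longleftrightarrow>
     1 \<in> C \<and> (\<forall>x\<in>C. - x \<in> C) \<and> (\<forall>x\<in>C. \<forall>y\<in>C. x + y \<in> C \<and> x * y \<in> C)"

text \<open>No unit is demanded: properness will mean omitting \<open>1\<close>, so that a maximal
  such set can serve as an ideal in the ring of its own multipliers.\<close>

definition subalgebra_over :: "'a::comm_ring_1 set \<Rightarrow> 'a set \<Rightarrow> bool" where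
  "subalgebra_over C S \<longleftrightarrow>
     0 \<in> S \<and> (\<forall>x\<in>S. \<forall>y\<in>S. x + y \<in> S \<and> x * y \<in> S) \<and> (\<forall>c\<in>C. \<forall>x\<in>S. c * x \<in> S)"

definition maximal_proper_subalgebra :: "'a::comm_ring_1 set \<Rightarrow> 'a set \<Rightarrow> bool" where
  "maximal_proper_subalgebra C S \<longleftrightarrow>
     subalgebra_over C S \<and> 1 \<notin> S \<and> (\<forall>T. subalgebra_over C T \<and> 1 \<notin> T \<and> S \<subseteq> T \<longrightarrow> T = S)"

lemma subalgebra_sum:
  assumes "subalgebra_over C S" "\<And>i. i \<in> I \<Longrightarrow> f i \<in> S"
  shows "sum f I \<in> S"
  using assms(2)
  by (induction I rule: infinite_finite_induct) (use assms(1) in \<open>auto simp: subalgebra_over_def\<close>)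

lemma subalgebra_diff:
  assumes "subring_of C" "subalgebra_over C S" "x \<in> S" "y \<in> S"
  shows "x - y \<in> S"
proof -
  have "-1 * y \<in> S"
    using assms unfolding subring_of_def subalgebra_over_def by blast
  then have "x + -1 * y \<in> S"
    using assms unfolding subalgebra_over_def by blast
  then show ?thesis by simp
qed

text \<open>The enlargement of \<open>S\<close> that is tested against maximality. It contains
  \<open>S\<close> and all products \<open>x * s\<close> with \<open>s\<close> in \<open>S\<close>,
  while \<open>x\<close> itself need not belong to it. If it contains \<open>1\<close>, this is a
  polynomial relation for \<open>x\<close> with coefficients in \<open>S\<close>.\<close>

lemma subalgebra_polys:
  assumes S: "subalgebra_over C S"
  shows "subalgebra_over C {poly p x |p. \<forall>i. coeff p i \<in> S}"
  unfolding subalgebra_over_def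
proof (intro conjI ballI)
  show "0 \<in> {poly p x |p. \<forall>i. coeff p i \<in> S}"
    using S by (auto simp: subalgebra_over_def intro!: exI[of _ 0])
next
  fix u v assume "u \<in> {poly p x |p. \<forall>i. coeff p i \<in> S}" "v \<in> {poly p x |p. \<forall>i. coeff p i \<in> S}"
  then obtain p q where p: "u = poly p x" "\<forall>i. coeff p i \<in> S" and q: "v = poly q x" "\<forall>i. coeff q i \<in> S"
    by auto
  show "u + v \<in> {poly p x |p. \<forall>i. coeff p i \<in> S}"
    using p q S by (auto simp: subalgebra_over_def intro!: exI[of _ "p + q"])
  have "coeff (p * q) i \<in> S" for i
    unfolding coeff_mult using p q S
    by (intro subalgebra_sum[OF S]) (auto simp: subalgebra_over_def)
  then show "u * v \<in> {poly p x |p. \<forall>i. coeff p i \<in> S}"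
    using p q by (auto intro!: exI[of _ "p * q"])
next
  fix c u assume "c \<in> C" "u \<in> {poly p x |p. \<forall>i. coeff p i \<in> S}"
  then obtain p where "c \<in> C" "u = poly p x" "\<forall>i. coeff p i \<in> S"
    by auto
  then show "c * u \<in> {poly p x |p. \<forall>i. coeff p i \<in> S}"
    using S by (auto simp: subalgebra_over_def intro!: exI[of _ "smult c p"])
qed

lemma power_mult_inverse:
  fixes x y :: "'a::comm_ring_1"
  assumes "x * y = 1" "j \<le> n"
  shows "x ^ n * y ^ j = x ^ (n - j)"
proof -
  have "x ^ n = x ^ (n - j) * x ^ j"
    using assms(2) by (simp flip: power_add)
  then have "x ^ n * y ^ j = x ^ (n - j) * (x * y) ^ j"
    by (simp add: mult.assoc power_mult_distrib)
  then show ?thesis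
    by (simp add: assms(1))
qed

text \<open>The degree-reduction step in Chevalley's extension theorem for places: of the two relations
  the longer one can be shortened by means of the other.\<close>

lemma not_both_unit_relations:
  fixes x y :: "'a::comm_ring_1"
  assumes C: "subring_of C" and S: "subalgebra_over C S" and one: "1 \<notin> S"
    and xy: "x * y = 1"
    and a: "\<forall>i. a i \<in> S" "(\<Sum>i\<le>n. a i * x ^ i) = 1"
    and b: "\<forall>i. b i \<in> S" "(\<Sum>i\<le>m. b i * y ^ i) = 1"
  shows False
  using xy a b
proof (induction "n + m" arbitrary: n m x y a b rule: less_induct)
  case less
  \<comment> \<open>The reduction for \<open>m \<le> n\<close>, stated for arbitrary data so that
    the remaining case follows by exchanging \<open>x\<close> and \<open>y\<close>.\<close>
  have *: False
    if xy: "x * y = 1" and a: "\<forall>i. a i \<in> S" "(\<Sum>i\<le>n. a i * x ^ i) = 1"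
    and b: "\<forall>i. b i \<in> S" "(\<Sum>i\<le>m. b i * y ^ i) = 1" and mn: "m \<le> n"
    and IH: "\<And>n' m' x y a b. n' + m' < n + m \<Longrightarrow> x * y = 1 \<Longrightarrow> \<forall>i. a i \<in> S \<Longrightarrow>
        (\<Sum>i\<le>n'. a i * x ^ i) = 1 \<Longrightarrow> \<forall>i. b i \<in> S \<Longrightarrow> (\<Sum>i\<le>m'. b i * y ^ i) = 1 \<Longrightarrow> False"
    for x y :: 'a and a b n m
  proof -
    have "m \<noteq> 0"
    proof
      assume "m = 0"
      then have "b 0 = 1" using b(2) by simp
      then show False using b(1) one by metis
    qed
    then have n: "n > 0" and m: "m > 0" using mn by auto
    \<comment> \<open>Multiplying the relation for \<open>y\<close> by \<open>x^n\<close> gives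
      \<open>x^n * (1 - b 0)\<close> as the sum of \<open>b j * x^(n - j)\<close> over
      \<open>j\<close> from \<open>1\<close> to \<open>m\<close>. Scale the relation for
      \<open>x\<close> by \<open>1 - b 0\<close>, substitute this for its top term and add
      \<open>b 0\<close>: the result is \<open>1\<close> again, now in degree below
      \<open>n\<close>. The factor \<open>1 - b 0\<close> is multiplied out because \<open>1\<close>
      is not in \<open>S\<close>.\<close>
    define a' where "a' i = (if i = 0 then b 0 else 0) + (a i - b 0 * a i)
      + (if n - m \<le> i then a n * b (n - i) else 0)" for i
    have a'S: "\<forall>i. a' i \<in> S"
    proof
      fix i
      have "a i - b 0 * a i \<in> S"
        using a b S by (intro subalgebra_diff[OF C S]) (auto simp: subalgebra_over_def)
      then show "a' i \<in> S"
        using a b S unfolding a'_def subalgebra_over_def by auto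
    qed
    have top: "(\<Sum>i<n. (if n - m \<le> i then a n * b (n - i) else 0) * x ^ i) = a n * x ^ n * (1 - b 0)"
    proof -
      have "(\<Sum>i<n. (if n - m \<le> i then a n * b (n - i) else 0) * x ^ i)
          = (\<Sum>i\<in>{n - m..<n}. a n * b (n - i) * x ^ i)"
        by (rule sum.mono_neutral_cong_right) auto
      also have "\<dots> = (\<Sum>j\<in>{1..m}. a n * b j * x ^ (n - j))"
        by (rule sum.reindex_bij_witness[of _ "\<lambda>j. n - j" "\<lambda>j. n - j"]) (use mn in auto)
      also have "\<dots> = (\<Sum>j\<in>{1..m}. a n * x ^ n * (b j * y ^ j))"
        using mn by (intro sum.cong) (auto simp: power_mult_inverse[OF xy, symmetric] mult_ac)
      also have "\<dots> = a n * x ^ n * (\<Sum>j\<in>{1..m}. b j * y ^ j)"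
        by (simp add: sum_distrib_left)
      also have "(\<Sum>j\<in>{1..m}. b j * y ^ j) = 1 - b 0"
        using b(2) by (simp add: atMost_atLeast0 sum.atLeast_Suc_atMost algebra_simps)
      finally show ?thesis .
    qed
    have low: "(\<Sum>i<n. a i * x ^ i) = 1 - a n * x ^ n"
      using a(2) by (simp add: lessThan_Suc_atMost[symmetric] algebra_simps)
    have zero: "(\<Sum>i<n. (if i = 0 then b 0 else 0) * x ^ i) = b 0"
      using n by (subst sum.remove[of _ 0]) (auto intro!: sum.neutral)
    have "(\<Sum>i<n. a' i * x ^ i) = (\<Sum>i<n. (if i = 0 then b 0 else 0) * x ^ i)
       + (1 - b 0) * (\<Sum>i<n. a i * x ^ i)
       + (\<Sum>i<n. (if n - m \<le> i then a n * b (n - i) else 0) * x ^ i)"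
      unfolding sum_distrib_left sum.distrib[symmetric] a'_def
      by (rule sum.cong) (auto simp: algebra_simps)
    also have "\<dots> = 1"
      unfolding top low zero by (simp add: algebra_simps)
    finally have "(\<Sum>i\<le>n - 1. a' i * x ^ i) = 1"
      using n by (metis Suc_pred' lessThan_Suc_atMost)
    then show False
      using IH[of "n - 1" m x y a' b] n xy a'S b by auto
  qed
  show ?case
  proof (cases "m \<le> n")
    case True
    show ?thesis
      using *[OF less.prems True] less.hyps by blast
  next
    case False
    show ?thesis
    proof (rule *[of y x b m a n])
      show "y * x = 1" using less.prems(1) by (simp add: mult.commute)
    qed (use less.prems less.hyps False in \<open>auto simp: add.commute\<close>)
  qed
qed

text \<open>If \<open>y * s\<close> escaped \<open>S\<close>, maximality would give a relation for
  \<open>y\<close>, hence none for \<open>x\<close>, so that \<open>x\<close> multiplies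
  \<open>S\<close> into itself. The relation for \<open>y\<close> times \<open>x^m\<close> puts
  \<open>x^m\<close> into \<open>S\<close>. Then adjoining \<open>x\<close> to \<open>S\<close> as
  an ideal of the multiplier ring cannot produce \<open>1\<close>, against maximality and
  \<open>x \<notin> S\<close>.\<close>

lemma maximal_proper_subalgebra_inverse:
  fixes x y :: "'a::comm_ring_1"
  assumes C: "subring_of C" and max: "maximal_proper_subalgebra C S"
    and xy: "x * y = 1" and x: "x \<notin> S" and s: "s \<in> S"
  shows "y * s \<in> S"
proof (rule ccontr)
  assume ys: "y * s \<notin> S"
  have S: "subalgebra_over C S" and one: "1 \<notin> S"
    using max by (auto simp: maximal_proper_subalgebra_def)
  have maxD: "T = S" if "subalgebra_over C T" "1 \<notin> T" "S \<subseteq> T" for T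
    using max that by (auto simp: maximal_proper_subalgebra_def)
  have S_polys: "z ^ i * u \<in> {poly p z |p. \<forall>i. coeff p i \<in> S}" if "u \<in> S" for u z i
    using that S
    by (auto simp: poly_monom subalgebra_over_def mult.commute intro!: exI[of _ "monom u i"])
  \<comment> \<open>When \<open>z * u\<close> lies outside \<open>S\<close>, the polynomials in
    \<open>z\<close> over \<open>S\<close> form a strictly larger subalgebra, which by maximality
    contains \<open>1\<close>.\<close>
  have relation: "\<exists>a n. (\<forall>i. a i \<in> S) \<and> (\<Sum>i\<le>n. a i * z ^ i) = 1"
    if "z * u \<notin> S" "u \<in> S" for z u
  proof -
    let ?T = "{poly p z |p. \<forall>i. coeff p i \<in> S}"
    have "S \<subseteq> ?T" "z * u \<in> ?T"
      using S_polys[of _ z 0] S_polys[OF that(2), of z 1] by auto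
    then have "1 \<in> ?T"
      using maxD[OF subalgebra_polys[OF S]] that by blast
    then obtain p where "1 = poly p z" "\<forall>i. coeff p i \<in> S"
      by auto
    then show ?thesis
      unfolding poly_altdef by metis
  qed
  obtain b m where b: "\<forall>i. b i \<in> S" "(\<Sum>i\<le>m. b i * y ^ i) = 1"
    using relation[OF ys s] by blast
  \<comment> \<open>A failure would give a relation for \<open>x\<close> besides the one for
    \<open>y\<close>.\<close>
  have xS: "x * u \<in> S" if u: "u \<in> S" for u
    using relation[OF _ u, of x] not_both_unit_relations[OF C S one xy _ _ b] by blast
  \<comment> \<open>The multiplier ring of \<open>S\<close>: the set \<open>S\<close> is an ideal in
    it, and by \<open>xS\<close> it contains \<open>x\<close>.\<close>
  define A where "A = {a. \<forall>u\<in>S. a * u \<in> S}"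
  have A: "1 \<in> A" "C \<subseteq> A" "S \<subseteq> A" "x \<in> A" "\<And>u v. u \<in> A \<Longrightarrow> v \<in> A \<Longrightarrow> u + v \<in> A"
      "\<And>u v. u \<in> A \<Longrightarrow> v \<in> A \<Longrightarrow> u * v \<in> A" "\<And>u n. u \<in> A \<Longrightarrow> u ^ n \<in> A" "0 \<in> A"
  proof -
    show "u ^ n \<in> A" if "u \<in> A" for u and n :: nat
      using that by (induction n) (auto simp: A_def mult.assoc)
  qed (use S xS in \<open>auto simp: A_def subalgebra_over_def mult.assoc distrib_right\<close>)
  have AS: "u * v \<in> S" "v * u \<in> S" if "u \<in> A" "v \<in> S" for u v
    using that by (auto simp: A_def mult.commute)
  have "x ^ m \<in> S"
  proof -
    have "x ^ m = (\<Sum>i\<le>m. b i * (x ^ m * y ^ i))"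
    proof -
      have "x ^ m = x ^ m * (\<Sum>i\<le>m. b i * y ^ i)" by (simp add: b)
      then show ?thesis by (simp only: sum_distrib_left mult.left_commute)
    qed
    also have "\<dots> = (\<Sum>i\<le>m. b i * x ^ (m - i))"
      by (intro sum.cong) (auto simp: power_mult_inverse[OF xy])
    also have "\<dots> \<in> S"
      using A AS b by (intro subalgebra_sum[OF S]) auto
    finally show ?thesis .
  qed
  \<comment> \<open>The ideal of \<open>A\<close> generated by \<open>S\<close> and
    \<open>x\<close>.\<close>
  let ?T = "{u + x * a |u a. u \<in> S \<and> a \<in> A}"
  have "subalgebra_over C ?T"
    unfolding subalgebra_over_def
  proof (intro conjI ballI)
    show "0 \<in> ?T"
      using A S by (auto simp: subalgebra_over_def intro!: exI[of _ 0])
  next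
    fix p q assume "p \<in> ?T" "q \<in> ?T"
    then obtain u a v b where p: "p = u + x * a" "u \<in> S" "a \<in> A" and q: "q = v + x * b" "v \<in> S" "b \<in> A"
      by auto
    have "p + q = (u + v) + x * (a + b)"
      by (simp add: p q algebra_simps)
    then show "p + q \<in> ?T"
      using A S p q unfolding subalgebra_over_def by blast
    have "p * q = u * v + x * (a * v + u * b + a * (x * b))"
      by (simp add: p q algebra_simps)
    moreover have "u * v \<in> S" "a * v + u * b + a * (x * b) \<in> A"
      using A S p q by (auto simp: subalgebra_over_def subset_iff)
    ultimately show "p * q \<in> ?T"
      by blast
  next
    fix c p assume "c \<in> C" "p \<in> ?T"
    then obtain u a where p: "p = u + x * a" "u \<in> S" "a \<in> A"
      by auto
    have "c * p = c * u + x * (c * a)"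
      by (simp add: p algebra_simps)
    then show "c * p \<in> ?T"
      using A S p \<open>c \<in> C\<close> unfolding subalgebra_over_def by blast
  qed
  moreover have "S \<subseteq> ?T"
    using A(8) by force
  moreover have "0 + x * 1 \<in> ?T"
    using A(1) S unfolding subalgebra_over_def by blast
  then have "x \<in> ?T"
    by simp
  ultimately have "1 \<in> ?T"
    using maxD[of ?T] x by (metis (no_types, lifting))
  then obtain u a where ua: "1 = u + x * a" "u \<in> S" "a \<in> A"
    by auto
  \<comment> \<open>\<open>x * a\<close> is nilpotent modulo \<open>S\<close>, so \<open>u = 1 - x * a\<close> is invertible modulo \<open>S\<close>.\<close>
  have "1 - (x * a) ^ m = u * (\<Sum>i<m. (x * a) ^ i)"
    using ua(1) one_diff_power_eq[of "x * a" m] by (metis add_diff_cancel_right')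
  moreover have "(\<Sum>i<m. (x * a) ^ i) \<in> A"
    using A ua by (induction m) auto
  moreover have "(x * a) ^ m \<in> S"
    unfolding power_mult_distrib by (intro AS A(7) \<open>x ^ m \<in> S\<close> ua)
  ultimately have "1 - (x * a) ^ m \<in> S" "(x * a) ^ m \<in> S"
    using AS(2) ua(2) by auto
  then have "(1 - (x * a) ^ m) + (x * a) ^ m \<in> S"
    using S unfolding subalgebra_over_def by blast
  then show False
    using one by simp
qed

lemma ex_maximal_proper_subalgebra:
  assumes "subalgebra_over C S0" "1 \<notin> S0"
  shows "\<exists>S. maximal_proper_subalgebra C S \<and> S0 \<subseteq> S"
proof -
  let ?F = "{S. subalgebra_over C S \<and> 1 \<notin> S \<and> S0 \<subseteq> S}"
  have "\<exists>M\<in>?F. \<forall>X\<in>?F. M \<subseteq> X \<longrightarrow> X = M"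
  proof (rule subset_Zorn_nonempty)
    show "?F \<noteq> {}"
      using assms by blast
  next
    fix \<C> assume ne: "\<C> \<noteq> {}" and ch: "subset.chain ?F \<C>"
    have sub: "\<And>X. X \<in> \<C> \<Longrightarrow> subalgebra_over C X \<and> 1 \<notin> X \<and> S0 \<subseteq> X"
      using ch by (auto simp: subset.chain_def)
    have both: "\<exists>X\<in>\<C>. u \<in> X \<and> v \<in> X" if "u \<in> \<Union>\<C>" "v \<in> \<Union>\<C>" for u v
    proof -
      from that obtain X Y where XY: "X \<in> \<C>" "u \<in> X" "Y \<in> \<C>" "v \<in> Y" by blast
      then have "X \<subseteq> Y \<or> Y \<subseteq> X"
        using ch by (auto simp: subset_chain_def)
      then show ?thesis using XY by blast
    qed
    have "subalgebra_over C (\<Union>\<C>)"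
      unfolding subalgebra_over_def
    proof (intro conjI ballI)
      show "0 \<in> \<Union>\<C>" using ne sub by (fastforce simp: subalgebra_over_def)
    next
      fix u v assume "u \<in> \<Union>\<C>" "v \<in> \<Union>\<C>"
      then obtain X where "X \<in> \<C>" "u \<in> X" "v \<in> X" using both by blast
      then show "u + v \<in> \<Union>\<C>" "u * v \<in> \<Union>\<C>"
        using sub unfolding subalgebra_over_def by blast+
    next
      fix c u assume "c \<in> C" "u \<in> \<Union>\<C>"
      then show "c * u \<in> \<Union>\<C>"
        using sub unfolding subalgebra_over_def by blast
    qed
    then show "\<Union>\<C> \<in> ?F"
      using ne sub by fastforce
  qed
  then obtain S where S: "S \<in> ?F" and max: "\<forall>X\<in>?F. S \<subseteq> X \<longrightarrow> X = S"
    by (rule bexE)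
  have "T = S" if "subalgebra_over C T" "1 \<notin> T" "S \<subseteq> T" for T
    using S that by (intro max[rule_format]) auto
  then show ?thesis
    using S unfolding maximal_proper_subalgebra_def by auto
qed

section \<open>Algebras of complex-valued functions over the constants\<close>

lemma subring_of_constants: "subring_of (range (\<lambda>c::complex. \<lambda>t::'t. c))"
  unfolding subring_of_def
proof (intro conjI ballI)
  show "1 \<in> range (\<lambda>c::complex. \<lambda>t::'t. c)"
    by (rule image_eqI[of _ _ 1]) (auto simp: fun_eq_iff)
next
  fix x assume "x \<in> range (\<lambda>c::complex. \<lambda>t::'t. c)"
  then obtain c where "x = (\<lambda>t. c)" by auto
  then show "- x \<in> range (\<lambda>c::complex. \<lambda>t::'t. c)"
    by (intro image_eqI[of _ _ "- c"]) (auto simp: fun_eq_iff)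
next
  fix x y assume "x \<in> range (\<lambda>c::complex. \<lambda>t::'t. c)" "y \<in> range (\<lambda>c::complex. \<lambda>t::'t. c)"
  then obtain c d where "x = (\<lambda>t. c)" "y = (\<lambda>t. d)" by auto
  then show "x + y \<in> range (\<lambda>c::complex. \<lambda>t::'t. c)" "x * y \<in> range (\<lambda>c::complex. \<lambda>t::'t. c)"
    by (intro image_eqI[of _ _ "c + d"] image_eqI[of _ _ "c * d"]; auto simp: fun_eq_iff)+
qed

text \<open>The algebra generated by \<open>q\<close> without its unit is proper since \<open>q\<close> is transcendental over the
  constants: a nonzero polynomial has finitely many roots.\<close>

lemma ex_maximal_proper_subalgebra_containing:
  fixes q :: "'t \<Rightarrow> complex"
  assumes inf: "infinite (range q)"
  shows "\<exists>S. maximal_proper_subalgebra (range (\<lambda>c. \<lambda>t. c)) S \<and> q \<in> S"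
proof -
  let ?S0 = "{(\<lambda>t. poly p (q t)) |p. coeff p 0 = 0}"
  have alg: "subalgebra_over (range (\<lambda>c. \<lambda>t. c)) ?S0"
    unfolding subalgebra_over_def
  proof (intro conjI ballI)
    show "0 \<in> ?S0"
      by (auto simp: fun_eq_iff intro!: exI[of _ 0])
  next
    fix f g assume "f \<in> ?S0" "g \<in> ?S0"
    then obtain p r where p: "f = (\<lambda>t. poly p (q t))" "coeff p 0 = 0" and r: "g = (\<lambda>t. poly r (q t))" "coeff r 0 = 0"
      by auto
    show "f + g \<in> ?S0"
      using p r by (auto simp: fun_eq_iff intro!: exI[of _ "p + r"])
    show "f * g \<in> ?S0"
      using p r by (auto simp: fun_eq_iff coeff_mult intro!: exI[of _ "p * r"])
  next
    fix c f assume "c \<in> range (\<lambda>c::complex. \<lambda>t::'t. c)" "f \<in> ?S0"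
    then obtain z p where "c = (\<lambda>t. z)" "f = (\<lambda>t. poly p (q t))" "coeff p 0 = 0"
      by auto
    then show "c * f \<in> ?S0"
      by (auto simp: fun_eq_iff intro!: exI[of _ "smult z p"])
  qed
  have "1 \<notin> ?S0"
  proof
    assume "1 \<in> ?S0"
    then obtain p where p: "1 = (\<lambda>t. poly p (q t))" "coeff p 0 = 0"
      by auto
    \<comment> \<open>Its constant coefficient is \<open>-1\<close>.\<close>
    have "p - 1 \<noteq> 0"
      using p(2) by auto
    then have "finite {z. poly (p - 1) z = 0}"
      using poly_roots_finite by blast
    moreover have "range q \<subseteq> {z. poly (p - 1) z = 0}"
      using p(1) by (auto simp: fun_eq_iff)
    ultimately show False
      using inf finite_subset by blast
  qed
  moreover have "q \<in> ?S0"
    by (auto intro!: exI[of _ "[:0, 1:]"])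
  ultimately show ?thesis
    using ex_maximal_proper_subalgebra[OF alg] by blast
qed


section \<open>Colorings and monochromatic paths\<close>

lemma reachable_refl: "(u, u) \<in> reachable F"
  by (simp add: reachable_def)

lemma reachable_edge: "{u, v} \<in> F \<Longrightarrow> (u, v) \<in> reachable F"
  by (auto simp: reachable_def)

lemma reachable_trans: "(u, v) \<in> reachable F \<Longrightarrow> (v, w) \<in> reachable F \<Longrightarrow> (u, w) \<in> reachable F"
  by (auto simp: reachable_def)

lemma reachable_sym:
  assumes "(u, v) \<in> reachable F"
  shows "(v, u) \<in> reachable F"
proof -
  have "sym {(u, v). {u, v} \<in> F}"
    by (auto simp: sym_def insert_commute)
  then show ?thesis
    using assms unfolding reachable_def by (meson symD sym_rtrancl)
qed

lemma reachable_induct [consumes 1, case_names refl step]: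
  assumes "(u, v) \<in> reachable F" "P u"
    and "\<And>x y. (u, x) \<in> reachable F \<Longrightarrow> {x, y} \<in> F \<Longrightarrow> P x \<Longrightarrow> P y"
  shows "P v"
  using assms unfolding reachable_def by (induction rule: rtrancl_induct) auto

text \<open>Paths without repeated vertices are the ones that an extra edge closes to a cycle. A
  path that would return to one of its vertices is cut off there.\<close>

lemma reachable_distinct_path:
  assumes "(u, v) \<in> reachable F"
  shows "\<exists>vs. vs \<noteq> [] \<and> hd vs = u \<and> last vs = v \<and> distinct vs \<and>
           (\<forall>i. Suc i < length vs \<longrightarrow> {vs ! i, vs ! Suc i} \<in> F)"
  using assms
proof (induction rule: reachable_induct)
  case refl
  show ?case by (intro exI[of _ "[u]"]) auto
next
  case (step y z)
  then obtain vs where vs: "vs \<noteq> []" "hd vs = u" "last vs = y" "distinct vs"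
      "\<And>i. Suc i < length vs \<Longrightarrow> {vs ! i, vs ! Suc i} \<in> F"
    by blast
  show ?case
  proof (cases "z \<in> set vs")
    case True
    then obtain i where i: "i < length vs" "vs ! i = z"
      by (auto simp: in_set_conv_nth)
    then have "last (take (Suc i) vs) = z"
      by (simp add: take_Suc_conv_app_nth)
    moreover have "hd (take (Suc i) vs) = u"
      using vs by simp
    ultimately show ?thesis
      using vs i by (intro exI[of _ "take (Suc i) vs"]) auto
  next
    case False
    have "{(vs @ [z]) ! i, (vs @ [z]) ! Suc i} \<in> F" if "Suc i < length (vs @ [z])" for i
    proof (cases "Suc i < length vs")
      case True
      then show ?thesis using vs(5)[of i] by (simp add: nth_append)
    next
      case False
      then have "i = length vs - 1" using that by auto
      then show ?thesis
        using step.hyps vs that False by (simp add: nth_append last_conv_nth)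
    qed
    then show ?thesis
      using vs False by (intro exI[of _ "vs @ [z]"]) auto
  qed
qed

section \<open>Cycles and monochromatic reachability\<close>

lemma edge_endpoints: "simple_graph V E \<Longrightarrow> {u, v} \<in> E \<Longrightarrow> u \<noteq> v \<and> u \<in> V \<and> v \<in> V"
  by (auto simp: simple_graph_def)

lemma edge_obtain:
  assumes "simple_graph V E" "e \<in> E"
  obtains u v where "e = {u, v}" "u \<noteq> v" "u \<in> V" "v \<in> V"
proof -
  have "card e = 2" "e \<subseteq> V"
    using assms by (auto simp: simple_graph_def)
  then show ?thesis
    using that by (auto simp: card_2_iff)
qed

text \<open>\<open>cycle_edges\<close> is a set, so counting edges by index needs injectivity. Two
  edges that coincide in reversed order would force \<open>i\<close> and \<open>i + 2\<close> to
  agree modulo the length, which length at least 3 excludes.\<close>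

lemma cycle_edges_inj:
  assumes "3 \<le> length vs" "distinct vs" "i < length vs" "j < length vs"
    and eq: "{vs ! i, vs ! (Suc i mod length vs)} = {vs ! j, vs ! (Suc j mod length vs)}"
  shows "i = j"
proof -
  have lt: "Suc i mod length vs < length vs" "Suc j mod length vs < length vs"
    using assms(1) by (auto intro!: mod_less_divisor)
  from eq consider "vs ! i = vs ! j" | "vs ! i = vs ! (Suc j mod length vs)" "vs ! (Suc i mod length vs) = vs ! j"
    by (auto simp: doubleton_eq_iff)
  then show ?thesis
  proof cases
    case 1
    then show ?thesis using assms by (simp add: nth_eq_iff_index_eq)
  next
    case 2
    then have "i = Suc j mod length vs" "Suc i mod length vs = j"
      using assms lt nth_eq_iff_index_eq by metis+
    then show ?thesis
      using assms by (auto simp: mod_Suc split: if_splits)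
  qed
qed

text \<open>Otherwise a path of color \<open>c\<close> from \<open>u\<close> to \<open>v\<close>,
  closed by the edge \<open>{u, v}\<close>, is a cycle with exactly one edge of the other
  color.\<close>

lemma NAC_coloring_reachable:
  assumes G: "simple_graph V E" and NAC: "NAC_coloring E \<delta>"
    and uv: "{u, v} \<in> E" and reach: "(u, v) \<in> reachable {e \<in> E. \<delta> e = c}"
  shows "\<delta> {u, v} = c"
proof (rule ccontr)
  assume neq: "\<delta> {u, v} \<noteq> c"
  obtain vs where vs: "vs \<noteq> []" "hd vs = u" "last vs = v" "distinct vs"
      "\<And>i. Suc i < length vs \<Longrightarrow> {vs ! i, vs ! Suc i} \<in> {e \<in> E. \<delta> e = c}"
    using reachable_distinct_path[OF reach] by blast
  let ?n = "length vs"
  have ends: "vs ! 0 = u" "vs ! (?n - 1) = v"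
    using vs by (auto simp: hd_conv_nth last_conv_nth)
  have "u \<noteq> v" using edge_endpoints[OF G uv] by simp
  then have "?n \<noteq> 1" using ends by auto
  \<comment> \<open>A path with two vertices is the edge \<open>{u, v}\<close> itself, which does
    not have color \<open>c\<close>.\<close>
  moreover have "?n \<noteq> 2"
    using ends vs(5)[of 0] neq by auto
  ultimately have n: "3 \<le> ?n"
    using vs(1) by (cases vs) (auto simp: neq_Nil_conv Suc_le_eq)
  have edge: "{vs ! i, vs ! (Suc i mod ?n)} \<in> E \<and>
      (\<delta> {vs ! i, vs ! (Suc i mod ?n)} = c \<or> {vs ! i, vs ! (Suc i mod ?n)} = {u, v})" if "i < ?n" for i
  proof (cases "Suc i < ?n")
    case True
    then show ?thesis using vs(5)[of i] by simp
  next
    case False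
    then have "Suc i = ?n" using that by simp
    then have "i = ?n - 1" "Suc i mod ?n = 0" by auto
    then have "vs ! i = v" "vs ! (Suc i mod ?n) = u" using ends by auto
    then show ?thesis using uv by (simp add: insert_commute)
  qed
  then have cyc: "is_cycle E vs"
    using n vs(4) by (auto simp: is_cycle_def cycle_edges_def)
  have last: "{u, v} \<in> cycle_edges vs"
  proof -
    have "Suc (?n - 1) = ?n"
      using n by simp
    then have "{u, v} = {vs ! (?n - 1), vs ! (Suc (?n - 1) mod ?n)}"
      using ends by (metis insert_commute mod_self)
    then show ?thesis
      using n unfolding cycle_edges_def by force
  qed
  have first: "{vs ! 0, vs ! 1} \<in> cycle_edges vs"
    using n unfolding cycle_edges_def by (auto intro!: exI[of _ 0])
  have "\<delta> {vs ! 0, vs ! 1} = c"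
    using vs(5)[of 0] n by auto
  then have "2 \<le> card {e \<in> cycle_edges vs. \<delta> e = \<delta> {u, v}}"
    using NAC cyc first last neq unfolding NAC_coloring_def by metis
  moreover have "{e \<in> cycle_edges vs. \<delta> e = \<delta> {u, v}} \<subseteq> {{u, v}}"
  proof
    fix f assume "f \<in> {e \<in> cycle_edges vs. \<delta> e = \<delta> {u, v}}"
    then obtain i where "i < ?n" "f = {vs ! i, vs ! (Suc i mod ?n)}" "\<delta> f = \<delta> {u, v}"
      unfolding cycle_edges_def by blast
    then have "f = {u, v}"
      using edge[of i] neq by metis
    then show "f \<in> {{u, v}}"
      by simp
  qed
  then have "card {e \<in> cycle_edges vs. \<delta> e = \<delta> {u, v}} \<le> card {{u, v}}"
    by (intro card_mono) auto
  ultimately show False by simp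
qed

text \<open>Converse criterion: in a cycle that violates the condition, one color occurs on a single
  edge, and the rest of the cycle joins the ends of that edge in the other color.\<close>

lemma NAC_coloringI:
  assumes surj: "\<delta> ` E = {Red, Blue}"
    and closed: "\<And>u v c. {u, v} \<in> E \<Longrightarrow> (u, v) \<in> reachable {e \<in> E. \<delta> e = c} \<Longrightarrow> \<delta> {u, v} = c"
  shows "NAC_coloring E \<delta>"
  unfolding NAC_coloring_def
proof (intro conjI surj allI impI)
  fix vs assume cyc: "is_cycle E vs"
  let ?n = "length vs" and ?e = "\<lambda>i. {vs ! i, vs ! (Suc i mod length vs)}"
  have n: "3 \<le> ?n" and dist: "distinct vs" and E: "\<And>i. i < ?n \<Longrightarrow> ?e i \<in> E"
    using cyc by (auto simp: is_cycle_def cycle_edges_def)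
  have fin: "finite (cycle_edges vs)"
    by (auto simp: cycle_edges_def)
  show "(\<exists>c. \<forall>e\<in>cycle_edges vs. \<delta> e = c) \<or> (\<forall>c. 2 \<le> card {e \<in> cycle_edges vs. \<delta> e = c})"
  proof (rule ccontr)
    assume "\<not> ?thesis"
    then obtain c where c: "card {e \<in> cycle_edges vs. \<delta> e = c} < 2"
        and nonmono: "\<And>c. \<exists>e\<in>cycle_edges vs. \<delta> e \<noteq> c"
      by (auto simp: not_le)
    define c' where "c' = (if c = Red then Blue else Red)"
    have c': "d = c \<or> d = c'" "c \<noteq> c'" for d
      by (cases d; cases c; simp add: c'_def)+
    obtain e where e: "e \<in> cycle_edges vs" "\<delta> e = c"
      using nonmono[of c'] c' by metis
    then obtain i where i: "i < ?n" "e = ?e i"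
      by (auto simp: cycle_edges_def)
    have only: "f = e" if f: "f \<in> cycle_edges vs" "\<delta> f = c" for f
    proof (rule ccontr)
      assume "f \<noteq> e"
      then have "card {e, f} \<le> card {e \<in> cycle_edges vs. \<delta> e = c}"
        using e f fin by (intro card_mono) auto
      then show False using c \<open>f \<noteq> e\<close> by simp
    qed
    have other: "?e j \<in> {e \<in> E. \<delta> e = c'}" if "j < ?n" "j \<noteq> i" for j
    proof -
      have "?e j \<noteq> e"
        using cycle_edges_inj[OF n dist that(1) i(1)] that i by metis
      moreover have "?e j \<in> cycle_edges vs"
        using that by (auto simp: cycle_edges_def)
      ultimately have "\<delta> (?e j) \<noteq> c"
        using only by blast
      then show ?thesis
        using c'(1) E[OF that(1)] by blast
    qed
    \<comment> \<open>Walk around the cycle, starting just behind the exceptional edge with index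
      \<open>i\<close>. Fewer than \<open>?n\<close> steps do not cross that edge, and
      \<open>?n - 1\<close> steps lead to its other end.\<close>
    have "(vs ! (Suc i mod ?n), vs ! ((Suc i + d) mod ?n)) \<in> reachable {e \<in> E. \<delta> e = c'}"
      if "d < ?n" for d
      using that
    proof (induction d)
      case 0
      then show ?case by (simp add: reachable_refl)
    next
      case (Suc d)
      let ?j = "(Suc i + d) mod ?n"
      have "?j \<noteq> i"
      proof
        assume j: "?j = i"
        show False
        proof (cases "Suc i + d < ?n")
          case True
          then show ?thesis using j by simp
        next
          case False
          then have "?j = Suc i + d - ?n"
            using Suc.prems i by (simp add: mod_if)
          then show ?thesis using j Suc.prems False by simp
        qed
      qed
      moreover have "?j < ?n"
        using i by (auto intro!: mod_less_divisor)
      ultimately have "(vs ! ?j, vs ! (Suc ?j mod ?n)) \<in> reachable {e \<in> E. \<delta> e = c'}"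
        by (intro reachable_edge other)
      moreover have "Suc ?j mod ?n = (Suc i + Suc d) mod ?n"
        by (simp add: mod_Suc_eq)
      ultimately show ?case
        using Suc by (auto intro: reachable_trans)
    qed
    moreover have "Suc i + (?n - 1) = i + ?n"
      using n by simp
    then have "(Suc i + (?n - 1)) mod ?n = i"
      using i by (metis mod_add_self2 mod_less)
    ultimately have "(vs ! (Suc i mod ?n), vs ! i) \<in> reachable {e \<in> E. \<delta> e = c'}"
      using n by (metis diff_less less_le_trans zero_less_numeral zero_less_one)
    then have "\<delta> e = c'"
      using closed[of "vs ! i" "vs ! (Suc i mod ?n)"] E i reachable_sym by metis
    then show False using e c' by simp
  qed
qed


section \<open>Rotations of the plane and equivariant labellings\<close>

definition to_complex :: "real^2 \<Rightarrow> complex" where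
  "to_complex p = Complex (p $ 1) (p $ 2)"

definition of_complex :: "complex \<Rightarrow> real^2" where
  "of_complex z = vector [Re z, Im z]"

lemma to_complex_of_complex [simp]: "to_complex (of_complex z) = z"
  by (simp add: to_complex_def of_complex_def)

lemma of_complex_to_complex [simp]: "of_complex (to_complex p) = p"
  by (simp add: to_complex_def of_complex_def vec_eq_iff forall_2)

lemma to_complex_eq_iff [simp]: "to_complex p = to_complex q \<longleftrightarrow> p = q"
  by (metis of_complex_to_complex)

lemma of_complex_eq_iff [simp]: "of_complex z = of_complex w \<longleftrightarrow> z = w"
  by (metis to_complex_of_complex)

lemma dist_to_complex [simp]: "dist (to_complex p) (to_complex q) = dist p q"
  by (simp add: dist_norm cmod_def to_complex_def norm_vec_def L2_set_def sum_2)

lemma dist_of_complex [simp]: "dist (of_complex z) (of_complex w) = dist z w"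
  by (metis dist_to_complex to_complex_of_complex)

lemma continuous_on_to_complex:
  "continuous_on S (f :: real \<Rightarrow> real^2) \<Longrightarrow> continuous_on S (\<lambda>t. to_complex (f t))"
  unfolding continuous_on_iff by simp

lemma continuous_on_of_complex:
  "continuous_on S (f :: real \<Rightarrow> complex) \<Longrightarrow> continuous_on S (\<lambda>t. of_complex (f t))"
  unfolding continuous_on_iff by simp

lemma to_complex_rotate_clockwise: "to_complex (rotate_clockwise a p) = cis (- a) * to_complex p"
  by (simp add: to_complex_def rotate_clockwise_def matrix_vector_mult_def sum_2 complex_eq_iff)

lemma rotate_clockwise_of_complex: "rotate_clockwise a (of_complex z) = of_complex (cis (- a) * z)"
  by (metis of_complex_to_complex to_complex_of_complex to_complex_rotate_clockwise)

text \<open>The \<open>k\<close>-th root of unity by which tau(omega^j) multiplies the complex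
  plane; the minus sign is the clockwise orientation.\<close>

definition rot :: "nat \<Rightarrow> int \<Rightarrow> complex" where
  "rot k j = cis (- (2 * real_of_int j * pi / real k))"

lemma rot_nonzero [simp]: "rot k j \<noteq> 0"
  by (simp add: rot_def)

lemma norm_rot [simp]: "norm (rot k j) = 1"
  by (simp add: rot_def)

lemma rot_add: "rot k (i + j) = rot k i * rot k j"
  by (simp add: rot_def cis_mult add_divide_distrib algebra_simps)

lemma rot_multiple: "k > 0 \<Longrightarrow> rot k (int k * n) = 1"
proof -
  assume "k > 0"
  then have "- (2 * real_of_int (int k * n) * pi / real k) = 2 * pi * of_int (- n)"
    by (simp add: field_simps)
  then show ?thesis
    unfolding rot_def by (metis Ints_of_int cis_multiple_2pi)
qed

lemma rot_mod: "k > 0 \<Longrightarrow> rot k (j mod int k) = rot k j"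
  by (metis add.commute mult.right_neutral mult_div_mod_eq rot_add rot_multiple)

lemma rot_neq_1:
  assumes "0 < j" "j < int k"
  shows "rot k j \<noteq> 1"
proof
  assume "rot k j = 1"
  then obtain n :: int where "- (2 * real_of_int j * pi / real k) = of_int (2 * n) * pi"
    by (auto simp: rot_def cis_conv_exp exp_eq_1)
  then have "pi * real_of_int j = pi * real_of_int (- n * int k)"
    using assms by (simp add: field_simps)
  then have "real_of_int j = real_of_int (- n * int k)"
    using mult_cancel_left pi_neq_zero by blast
  then have "j = - n * int k"
    by linarith
  then have "int k dvd j"
    by simp
  then show False
    using assms zdvd_not_zless by blast
qed

lemma rot_inj:
  assumes "i \<in> {0..<int k}" "j \<in> {0..<int k}" "rot k i = rot k j"
  shows "i = j"
proof -
  have *: "a = b" if "a \<in> {0..<int k}" "b \<in> {0..<int k}" "rot k a = rot k b" "a \<le> b" for a b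
  proof (rule ccontr)
    assume "a \<noteq> b"
    have "rot k a * rot k (b - a) = rot k a"
      using rot_add[of k a "b - a"] that(3) by simp
    then have "rot k (b - a) = 1"
      using rot_nonzero by (metis mult.right_neutral mult_cancel_left)
    then show False
      using rot_neq_1[of "b - a" k] that \<open>a \<noteq> b\<close> by auto
  qed
  show ?thesis
    using *[of i j] *[of j i] assms by (cases "i \<le> j") auto
qed

text \<open>Number the orbits by positive integers and choose a representative in each; label a
  point by the number of its orbit, rotated by the group element that carries the representative to
  the point. Then the modulus determines the orbit and the argument the point within a free orbit. A
  point fixed by some \<open>j \<noteq> 0\<close> must get the label \<open>0\<close>, since
  \<open>rot k j \<noteq> 1\<close>; hence the exception to injectivity.\<close>

lemma equivariant_labelling:
  fixes \<phi> :: "int \<Rightarrow> 'x \<Rightarrow> 'x"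
  assumes k: "0 < k" and count: "countable X"
    and closed: "\<And>j x. j \<in> {0..<int k} \<Longrightarrow> x \<in> X \<Longrightarrow> \<phi> j x \<in> X"
    and zero: "\<And>x. x \<in> X \<Longrightarrow> \<phi> 0 x = x"
    and add: "\<And>i j x. i \<in> {0..<int k} \<Longrightarrow> j \<in> {0..<int k} \<Longrightarrow> x \<in> X \<Longrightarrow>
                 \<phi> ((i + j) mod int k) x = \<phi> i (\<phi> j x)"
  shows "\<exists>f :: 'x \<Rightarrow> complex. (\<forall>j\<in>{0..<int k}. \<forall>x\<in>X. f (\<phi> j x) = rot k j * f x) \<and>
           (\<forall>x\<in>X. \<forall>y\<in>X. f x = f y \<longrightarrow> x = y \<or>
              (\<exists>j\<in>{0..<int k}. j \<noteq> 0 \<and> \<phi> j x = x) \<and> (\<exists>j\<in>{0..<int k}. j \<noteq> 0 \<and> \<phi> j y = y))"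
proof -
  let ?J = "{0..<int k}"
  define fixd where "fixd x \<longleftrightarrow> (\<exists>j\<in>?J. j \<noteq> 0 \<and> \<phi> j x = x)" for x
  define orb where "orb x = (\<lambda>j. \<phi> j x) ` ?J" for x
  \<comment> \<open>The choice depends on \<open>x\<close> only through its orbit, so all points of
    an orbit share the representative.\<close>
  define rep where "rep x = (SOME y. y \<in> orb x)" for x
  define ix where "ix x = (SOME j. j \<in> ?J \<and> \<phi> j (rep x) = x)" for x
  \<comment> \<open>\<open>Suc\<close> keeps the labels of free points away from \<open>0\<close>,
    the label of points with a nontrivial stabilizer.\<close>
  define f where "f x = (if fixd x then 0 else of_nat (Suc (to_nat_on X (rep x))) * rot k (ix x))" for x
  have modJ: "j mod int k \<in> ?J" for j
    using k by auto
  have J0: "0 \<in> ?J"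
    using k by auto
  have inv: "\<phi> ((- j) mod int k) (\<phi> j x) = x" if "j \<in> ?J" "x \<in> X" for j x
    using add[OF modJ that, of "- j"] zero that by (simp add: mod_simps)
  have orb_act: "orb (\<phi> i x) = orb x" if i: "i \<in> ?J" and x: "x \<in> X" for i x
  proof -
    have 1: "orb (\<phi> i x) \<subseteq> orb x" if i: "i \<in> ?J" and x: "x \<in> X" for i x
      using add[OF _ i x] modJ by (auto simp: orb_def simp flip: add[OF _ i x])
    have "orb (\<phi> ((- i) mod int k) (\<phi> i x)) \<subseteq> orb (\<phi> i x)"
      using 1[OF modJ closed[OF i x]] .
    then show ?thesis
      using 1[OF i x] inv[OF i x] by auto
  qed
  have rep_orb: "rep x \<in> orb x" if "x \<in> X" for x
  proof -
    have "\<phi> 0 x \<in> orb x"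
      using J0 unfolding orb_def by (rule imageI)
    then show ?thesis
      unfolding rep_def by (rule someI)
  qed
  have rep_X: "rep x \<in> X" if "x \<in> X" for x
    using rep_orb[OF that] closed that by (auto simp: orb_def)
  have ix: "ix x \<in> ?J \<and> \<phi> (ix x) (rep x) = x" if x: "x \<in> X" for x
  proof -
    obtain i where i: "i \<in> ?J" "rep x = \<phi> i x"
      using rep_orb[OF x] unfolding orb_def by blast
    then have "(- i) mod int k \<in> ?J \<and> \<phi> ((- i) mod int k) (rep x) = x"
      using modJ inv x by metis
    then show ?thesis
      unfolding ix_def by (rule someI)
  qed
  have rep_act: "rep (\<phi> i x) = rep x" if "i \<in> ?J" "x \<in> X" for i x
    using orb_act[OF that] by (simp add: rep_def)
  have fixd_imp: "fixd (\<phi> i x)" if i: "i \<in> ?J" and x: "x \<in> X" and fixd: "fixd x" for i x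
  proof -
    obtain j where j: "j \<in> ?J" "j \<noteq> 0" "\<phi> j x = x"
      using fixd by (auto simp: fixd_def)
    have "\<phi> j (\<phi> i x) = \<phi> i (\<phi> j x)"
      using add[OF i j(1) x] add[OF j(1) i x] by (simp add: add.commute)
    then show ?thesis
      using j by (auto simp: fixd_def)
  qed
  have fixd_act: "fixd (\<phi> i x) \<longleftrightarrow> fixd x" if "i \<in> ?J" "x \<in> X" for i x
    using fixd_imp[OF that] fixd_imp[OF modJ closed[OF that], of "- i"] inv[OF that] by metis
  have free: "i = j" if x: "x \<in> X" "\<not> fixd x" and ij: "i \<in> ?J" "j \<in> ?J" "\<phi> i x = \<phi> j x" for x i j
  proof -
    have "\<phi> (((- j) mod int k + i) mod int k) x = x"
      using add[OF modJ ij(1) x(1), of "- j"] ij inv[OF ij(2) x(1)] by simp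
    then have "((- j) mod int k + i) mod int k = 0"
      using x(2) modJ unfolding fixd_def by blast
    then have "(i - j) mod int k = 0"
      by (simp add: mod_simps)
    then have "i mod int k = j mod int k"
      using mod_eq_dvd_iff by blast
    then show ?thesis
      using ij by simp
  qed
  have "f (\<phi> j x) = rot k j * f x" if j: "j \<in> ?J" and x: "x \<in> X" for j x
  proof (cases "fixd x")
    case True
    then show ?thesis using fixd_act[OF j x] by (simp add: f_def)
  next
    case False
    \<comment> \<open>Two group elements carry the representative to \<open>\<phi> j x\<close>; as
      the orbit is free, they are equal.\<close>
    have "\<phi> (ix (\<phi> j x)) (rep x) = \<phi> ((j + ix x) mod int k) (rep x)"
      using ix[OF closed[OF j x]] ix[OF x] rep_act[OF j x] add[OF j _ rep_X[OF x]] by simp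
    moreover have "\<not> fixd (rep x)"
      using ix[OF x] fixd_act[OF _ rep_X[OF x]] False by metis
    ultimately have "ix (\<phi> j x) = (j + ix x) mod int k"
      using free[OF rep_X[OF x]] ix[OF closed[OF j x]] modJ by blast
    then have "rot k (ix (\<phi> j x)) = rot k j * rot k (ix x)"
      by (simp add: rot_mod[OF k] rot_add)
    then show ?thesis
      using False fixd_act[OF j x] rep_act[OF j x] by (simp add: f_def)
  qed
  moreover have "x = y \<or> fixd x \<and> fixd y" if x: "x \<in> X" and y: "y \<in> X" and eq: "f x = f y" for x y
  proof -
    have nz: "f x = 0 \<longleftrightarrow> fixd x" for x
      unfolding f_def by (simp del: of_nat_Suc)
    have "x = y" if nf: "\<not> fixd x" "\<not> fixd y"
    proof -
      have eq': "of_nat (Suc (to_nat_on X (rep x))) * rot k (ix x)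
          = of_nat (Suc (to_nat_on X (rep y))) * rot k (ix y)"
        using eq nf by (simp add: f_def)
      then have "norm (of_nat (Suc (to_nat_on X (rep x))) * rot k (ix x))
          = norm (of_nat (Suc (to_nat_on X (rep y))) * rot k (ix y))"
        by (rule arg_cong)
      then have "Suc (to_nat_on X (rep x)) = Suc (to_nat_on X (rep y))"
        unfolding norm_mult norm_of_nat norm_rot by (metis mult.right_neutral of_nat_eq_iff)
      then have rep: "rep x = rep y"
        using count rep_X x y by simp
      then have "rot k (ix x) = rot k (ix y)"
        using eq' by (metis mult_cancel_left of_nat_neq_0)
      then have "ix x = ix y"
        using rot_inj ix x y by blast
      then show ?thesis
        using ix rep x y by metis
    qed
    then show ?thesis
      using nz eq by metis
  qed
  ultimately have "(\<forall>j\<in>?J. \<forall>x\<in>X. f (\<phi> j x) = rot k j * f x) \<and>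
      (\<forall>x\<in>X. \<forall>y\<in>X. f x = f y \<longrightarrow> x = y \<or> fixd x \<and> fixd y)"
    by simp
  then show ?thesis
    unfolding fixd_def by (rule exI[of _ f])
qed


section \<open>From a motion to a coloring\<close>

text \<open>The pointwise form in which the ideal is used, with membership in \<open>S\<close> read
  as being small. The last clause is the valuation property: dividing by a function that is not
  small preserves smallness.\<close>

lemma ex_valuation_ideal:
  fixes q :: "'t \<Rightarrow> complex"
  assumes "infinite (range q)"
  shows "\<exists>S. q \<in> S \<and> (\<lambda>t. 1) \<notin> S \<and>
    (\<forall>f g. f \<in> S \<longrightarrow> g \<in> S \<longrightarrow> (\<lambda>t. f t + g t) \<in> S) \<and>
    (\<forall>c f. f \<in> S \<longrightarrow> (\<lambda>t. c * f t) \<in> S) \<and>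
    (\<forall>f g h. (\<forall>t. f t * g t = 1) \<longrightarrow> f \<notin> S \<longrightarrow> h \<in> S \<longrightarrow> (\<lambda>t. g t * h t) \<in> S)"
proof -
  obtain S where max: "maximal_proper_subalgebra (range (\<lambda>c. \<lambda>t. c)) S" and q: "q \<in> S"
    using ex_maximal_proper_subalgebra_containing[OF assms] by blast
  then have S: "subalgebra_over (range (\<lambda>c. \<lambda>t. c)) S" and one: "1 \<notin> S"
    by (auto simp: maximal_proper_subalgebra_def)
  have "(\<lambda>t. 1) \<notin> S"
    using one by (simp add: one_fun_def)
  moreover have "(\<lambda>t. f t + g t) \<in> S" if "f \<in> S" "g \<in> S" for f g
  proof -
    have "f + g \<in> S"
      using S that unfolding subalgebra_over_def by blast
    then show ?thesis by (simp add: plus_fun_def)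
  qed
  moreover have "(\<lambda>t. c * f t) \<in> S" if "f \<in> S" for c f
  proof -
    have "(\<lambda>t. c) * f \<in> S"
      using S that unfolding subalgebra_over_def by blast
    then show ?thesis by (simp add: times_fun_def)
  qed
  moreover have "(\<lambda>t. g t * h t) \<in> S" if "\<forall>t. f t * g t = 1" "f \<notin> S" "h \<in> S" for f g h
  proof -
    have "f * g = 1"
      using that(1) by (simp add: fun_eq_iff)
    then have "g * h \<in> S"
      using maximal_proper_subalgebra_inverse[OF subring_of_constants max] that by blast
    then show ?thesis by (simp add: times_fun_def)
  qed
  ultimately show ?thesis
    using q by (intro exI[of _ S]) simp
qed

section \<open>The cyclic action on vertices and on monochromatic components\<close>

locale symmetric_action =
  fixes k :: nat and \<theta> :: "int \<Rightarrow> 'v \<Rightarrow> 'v" and V :: "'v set" and E :: "'v set set"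
  assumes k2: "2 \<le> k" and symmetric: "symmetric_graph k \<theta> V E"
begin

abbreviation J :: "int set" where "J \<equiv> {0..<int k}"

lemma carrier_cyclic: "carrier (cyclic k) = J"
  using k2 by (simp add: carrier_integer_mod_group)

lemma simple: "simple_graph V E"
  using symmetric by (simp add: symmetric_graph_def)

lemma action_hom: "\<theta> \<in> hom (cyclic k) (graph_aut_group V E)"
  using symmetric by (simp add: symmetric_graph_def acts_on_graph_def)

lemma action_Bij: "\<gamma> \<in> J \<Longrightarrow> \<theta> \<gamma> \<in> Bij V"
  using action_hom by (auto simp: hom_def carrier_cyclic graph_aut_group_def)

lemma action_bij: "\<gamma> \<in> J \<Longrightarrow> bij_betw (\<theta> \<gamma>) V V"
  using action_Bij by (auto simp: Bij_def)

lemma action_closed: "\<gamma> \<in> J \<Longrightarrow> v \<in> V \<Longrightarrow> \<theta> \<gamma> v \<in> V"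
  using action_bij bij_betwE by blast

lemma action_edge: "\<gamma> \<in> J \<Longrightarrow> {u, v} \<in> E \<Longrightarrow> {\<theta> \<gamma> u, \<theta> \<gamma> v} \<in> E"
proof -
  assume \<gamma>: "\<gamma> \<in> J" and e: "{u, v} \<in> E"
  have "\<theta> \<gamma> \<in> carrier (graph_aut_group V E)"
    using \<gamma> action_hom by (auto simp: hom_def carrier_cyclic)
  then show "{\<theta> \<gamma> u, \<theta> \<gamma> v} \<in> E"
    using e edge_endpoints[OF simple e] by (auto simp: graph_aut_group_def)
qed

lemma action_add:
  assumes "a \<in> J" "b \<in> J" "v \<in> V"
  shows "\<theta> ((a + b) mod int k) v = \<theta> a (\<theta> b v)"
proof -
  have "\<theta> (a \<otimes>\<^bsub>cyclic k\<^esub> b) = \<theta> a \<otimes>\<^bsub>graph_aut_group V E\<^esub> \<theta> b"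
    using action_hom assms by (auto simp: hom_def carrier_cyclic)
  then have "\<theta> ((a + b) mod int k) = compose V (\<theta> a) (\<theta> b)"
    using assms action_Bij by (simp add: graph_aut_group_def BijGroup_def)
  then show ?thesis
    using assms by (simp add: compose_def)
qed

lemma zero_J: "0 \<in> J"
  using k2 by auto

lemma mod_J: "j mod int k \<in> J"
  using k2 by auto

lemma action_zero:
  assumes "v \<in> V"
  shows "\<theta> 0 v = v"
proof -
  have "\<theta> 0 (\<theta> 0 v) = \<theta> 0 v"
    using action_add[OF zero_J zero_J assms] by simp
  then show ?thesis
    using bij_betw_imp_inj_on[OF action_bij[OF zero_J]] action_closed[OF zero_J assms] assms
    by (meson inj_onD)
qed

lemma action_inverse:
  assumes "j \<in> J" "v \<in> V"
  shows "\<theta> (- j mod int k) (\<theta> j v) = v"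
  using action_add[OF mod_J assms, of "- j"] action_zero assms by (simp add: mod_simps)

definition component :: "('v set \<Rightarrow> color) \<Rightarrow> color \<Rightarrow> 'v \<Rightarrow> 'v set" where
  "component \<delta> c v = {w \<in> V. (v, w) \<in> reachable {e \<in> E. \<delta> e = c}}"

lemma color_components_eq: "color_components V E \<delta> c = component \<delta> c ` V"
  by (auto simp: color_components_def components_of_graph_def component_def)

lemma component_self: "v \<in> V \<Longrightarrow> v \<in> component \<delta> c v"
  by (simp add: component_def reachable_refl)

lemma component_eq_iff:
  assumes "u \<in> V" "v \<in> V"
  shows "component \<delta> c u = component \<delta> c v \<longleftrightarrow> (u, v) \<in> reachable {e \<in> E. \<delta> e = c}"
proof
  assume "component \<delta> c u = component \<delta> c v"
  then show "(u, v) \<in> reachable {e \<in> E. \<delta> e = c}"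
    using component_self[OF assms(2), of \<delta> c] by (auto simp: component_def)
next
  assume "(u, v) \<in> reachable {e \<in> E. \<delta> e = c}"
  then show "component \<delta> c u = component \<delta> c v"
    unfolding component_def using reachable_trans[of u v] reachable_trans[of v u] reachable_sym[of u v]
    by blast
qed

lemma color_component_eq:
  assumes "H \<in> color_components V E \<delta> c" "u \<in> H"
  shows "H = component \<delta> c u"
proof -
  obtain v where v: "v \<in> V" "H = component \<delta> c v"
    using assms(1) by (auto simp: color_components_eq)
  then have "u \<in> V" "(v, u) \<in> reachable {e \<in> E. \<delta> e = c}"
    using assms(2) by (auto simp: component_def)
  then show ?thesis
    using v component_eq_iff by blast
qed

lemma component_subset: "component \<delta> c v \<subseteq> V"
  by (auto simp: component_def)

text \<open>Each group element transports monochromatic paths; applying this to its inverse gives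
  the reverse inclusion.\<close>

lemma component_action:
  assumes inv: "\<forall>\<gamma>\<in>J. \<forall>e\<in>E. \<delta> (\<theta> \<gamma> ` e) = \<delta> e" and \<gamma>: "\<gamma> \<in> J" and v: "v \<in> V"
  shows "\<theta> \<gamma> ` component \<delta> c v = component \<delta> c (\<theta> \<gamma> v)"
proof -
  have reach: "(\<theta> \<gamma> a, \<theta> \<gamma> b) \<in> reachable {e \<in> E. \<delta> e = c}"
    if "(a, b) \<in> reachable {e \<in> E. \<delta> e = c}" and \<gamma>: "\<gamma> \<in> J" for a b \<gamma>
    using that(1)
  proof (induction rule: reachable_induct)
    case refl
    show ?case by (rule reachable_refl)
  next
    case (step x y)
    then have "{\<theta> \<gamma> x, \<theta> \<gamma> y} \<in> {e \<in> E. \<delta> e = c}"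
      using action_edge[OF \<gamma>] inv \<gamma> by force
    then show ?case
      by (rule reachable_trans[OF step.IH reachable_edge])
  qed
  show ?thesis
  proof
    show "\<theta> \<gamma> ` component \<delta> c v \<subseteq> component \<delta> c (\<theta> \<gamma> v)"
      using reach[OF _ \<gamma>] action_closed[OF \<gamma>] by (auto simp: component_def)
    show "component \<delta> c (\<theta> \<gamma> v) \<subseteq> \<theta> \<gamma> ` component \<delta> c v"
    proof
      fix w assume w: "w \<in> component \<delta> c (\<theta> \<gamma> v)"
      then have "w \<in> V" by (simp add: component_def)
      then obtain u where u: "u \<in> V" "w = \<theta> \<gamma> u"
        using bij_betw_imp_surj_on[OF action_bij[OF \<gamma>]] by blast
      have "(\<theta> (- \<gamma> mod int k) (\<theta> \<gamma> v), \<theta> (- \<gamma> mod int k) w) \<in> reachable {e \<in> E. \<delta> e = c}"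
        using w by (intro reach mod_J) (simp add: component_def)
      then show "w \<in> \<theta> \<gamma> ` component \<delta> c v"
        using u action_inverse[OF \<gamma>] v by (auto simp: component_def)
    qed
  qed
qed

text \<open>Displacements, divided by that of the reference edge, are small along red paths. Along
  blue paths the conjugate displacement times any small one is small. An edge satisfying both would
  make its constant squared length small, but nonzero constants are not in \<open>S\<close>.\<close>

lemma symmetric_NAC_coloring_of_motion:
  fixes w :: "'v \<Rightarrow> 't \<Rightarrow> complex"
  assumes distinct: "\<And>u v t. {u, v} \<in> E \<Longrightarrow> w u t \<noteq> w v t"
    and len: "\<And>u v t. {u, v} \<in> E \<Longrightarrow> cmod (w u t - w v t) = l u v"
    and equiv: "\<And>j v t. j \<in> J \<Longrightarrow> v \<in> V \<Longrightarrow> w (\<theta> j v) t = rot k j * w v t"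
    and e0: "{u0, v0} \<in> E" and e1: "{u1, v1} \<in> E"
    and inf: "infinite (range (\<lambda>t. (w u1 t - w v1 t) / (w u0 t - w v0 t)))"
  shows "\<exists>\<delta>. symmetric_NAC_coloring k \<theta> V E \<delta>"
proof -
  obtain S where S: "(\<lambda>t. (w u1 t - w v1 t) / (w u0 t - w v0 t)) \<in> S" "(\<lambda>t. 1) \<notin> S"
    "\<forall>f g. f \<in> S \<longrightarrow> g \<in> S \<longrightarrow> (\<lambda>t. f t + g t) \<in> S"
    "\<forall>c f. f \<in> S \<longrightarrow> (\<lambda>t. c * f t) \<in> S"
    "\<forall>f g h. (\<forall>t. f t * g t = 1) \<longrightarrow> f \<notin> S \<longrightarrow> h \<in> S \<longrightarrow> (\<lambda>t. g t * h t) \<in> S"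
    using ex_valuation_ideal[OF inf] by (elim exE conjE)
  note S = S(1,2) S(3-5)[rule_format]
  \<comment> \<open>Normalised positions and displacements: \<open>D u0 v0\<close> is the constant
    \<open>1\<close>, so this edge becomes blue, and \<open>D u1 v1\<close> lies in
    \<open>S\<close>, so that edge becomes red.\<close>
  define r where "r v t = w v t / (w u0 t - w v0 t)" for v t
  define D where "D u v t = r u t - r v t" for u v t
  have nz: "w u0 t - w v0 t \<noteq> 0" for t
    using distinct[OF e0] by simp
  have D_eq: "D u v t = (w u t - w v t) / (w u0 t - w v0 t)" for u v t
    by (simp add: D_def r_def diff_divide_distrib)
  have S_scaleD: "(\<lambda>t. f t) \<in> S" if "(\<lambda>t. c * f t) \<in> S" "c \<noteq> 0" for c f
    using S(4)[OF that(1), of "inverse c"] that(2) by (simp flip: mult.assoc)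
  have S_const: "(\<lambda>t. c) \<notin> S" if "c \<noteq> 0" for c
    using S_scaleD[of c "\<lambda>t. 1"] S(2) that by auto
  have S_zero: "(\<lambda>t. 0) \<in> S"
    using S(4)[OF S(1), of 0] by simp
  have D_swap: "D v u \<in> S" if "D u v \<in> S" for u v
    using S(4)[OF that, of "- 1"] by (simp add: D_def[abs_def])
  define \<delta> where "\<delta> e = (if \<exists>u v. e = {u, v} \<and> D u v \<in> S then Red else Blue)" for e
  have Red_iff: "\<delta> {u, v} = Red \<longleftrightarrow> D u v \<in> S" for u v
    unfolding \<delta>_def using D_swap by (auto simp: doubleton_eq_iff)
  have Blue_iff: "\<delta> {u, v} = Blue \<longleftrightarrow> D u v \<notin> S" for u v
    using Red_iff[of u v] by (cases "\<delta> {u, v}") auto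
  have red_path: "D u v \<in> S" if "(u, v) \<in> reachable {e \<in> E. \<delta> e = Red}" for u v
    using that
  proof (induction rule: reachable_induct)
    case refl
    then show ?case using S_zero by (simp add: D_def[abs_def])
  next
    case (step x y)
    then have "D x y \<in> S" using Red_iff by simp
    with step.IH have "(\<lambda>t. D u x t + D x y t) \<in> S"
      by (rule S(3))
    moreover have "(\<lambda>t. D u x t + D x y t) = D u y"
      by (simp add: D_def fun_eq_iff)
    ultimately show ?case
      by simp
  qed
  have conj_mult: "cnj (w u t - w v t) * (w u t - w v t) = of_real ((l u v)\<^sup>2)" if "{u, v} \<in> E" for u v t
    using complex_norm_square[of "w u t - w v t"] len[OF that, of t] by (simp add: mult.commute)
  \<comment> \<open>Since \<open>cnj W * W\<close> is constant along an edge, complex conjugation turns small into large.\<close>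
  have blue_edge: "(\<lambda>t. cnj (w a t - w b t) * (w x t - w y t)) \<in> S"
    if ab: "{a, b} \<in> E" "D a b \<notin> S" and xy: "D x y \<in> S" for a b x y
  proof -
    have ne: "w a t - w b t \<noteq> 0" for t
      using distinct[OF ab(1)] by simp
    \<comment> \<open>\<open>D a b\<close> is not small, so its inverse preserves \<open>S\<close>.
      Applied to \<open>D x y\<close> it gives the quotient of the displacements of
      \<open>x y\<close> and \<open>a b\<close>; the constant squared length of \<open>a b\<close>
      then turns the division into multiplication by the conjugate.\<close>
    have "D a b t * ((w u0 t - w v0 t) / (w a t - w b t)) = 1" for t
      using ne[of t] nz[of t] by (simp add: D_eq)
    from S(5)[OF this ab(2) xy]
    have "(\<lambda>t. of_real ((l a b)\<^sup>2) * ((w u0 t - w v0 t) / (w a t - w b t) * D x y t)) \<in> S"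
      by (rule S(4))
    moreover have "of_real ((l a b)\<^sup>2) * ((w u0 t - w v0 t) / (w a t - w b t) * D x y t)
        = cnj (w a t - w b t) * (w x t - w y t)" for t
      using ne[of t] nz[of t] unfolding conj_mult[OF ab(1), of t, symmetric] by (simp add: D_eq)
    ultimately show ?thesis
      by simp
  qed
  have blue_path: "(\<lambda>t. cnj (w u t - w v t) * (w x t - w y t)) \<in> S"
    if "(u, v) \<in> reachable {e \<in> E. \<delta> e = Blue}" and xy: "D x y \<in> S" for u v x y
    using that(1)
  proof (induction rule: reachable_induct)
    case refl
    then show ?case using S_zero by simp
  next
    case (step a b)
    then have "{a, b} \<in> E" "D a b \<notin> S"
      using Blue_iff[of a b] by simp_all
    then have "(\<lambda>t. cnj (w a t - w b t) * (w x t - w y t)) \<in> S"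
      using xy by (rule blue_edge)
    with step.IH have "(\<lambda>t. cnj (w u t - w a t) * (w x t - w y t) + cnj (w a t - w b t) * (w x t - w y t)) \<in> S"
      by (rule S(3))
    moreover have "cnj (w u t - w a t) * (w x t - w y t) + cnj (w a t - w b t) * (w x t - w y t)
        = cnj (w u t - w b t) * (w x t - w y t)" for t
      by (simp add: algebra_simps)
    ultimately show ?case
      by simp
  qed
  have not_both: "(\<lambda>t. cnj (w u t - w v t) * (w u t - w v t)) \<notin> S" if "{u, v} \<in> E" for u v
  proof -
    have "l u v \<noteq> 0"
      using distinct[OF that, of undefined] len[OF that, of undefined] by auto
    then show ?thesis
      unfolding conj_mult[OF that] by (intro S_const) simp
  qed
  have NAC: "NAC_coloring E \<delta>"
  proof (rule NAC_coloringI)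
    have "D u0 v0 = (\<lambda>t. 1)"
      using nz by (simp add: D_eq fun_eq_iff)
    then have "\<delta> {u0, v0} = Blue"
      using S(2) Blue_iff by simp
    moreover have "D u1 v1 = (\<lambda>t. (w u1 t - w v1 t) / (w u0 t - w v0 t))"
      by (simp add: D_eq fun_eq_iff)
    then have "\<delta> {u1, v1} = Red"
      using S(1) Red_iff by simp
    ultimately have "Blue \<in> \<delta> ` E" "Red \<in> \<delta> ` E"
      using e0 e1 by (metis image_eqI)+
    moreover have "c \<in> {Red, Blue}" for c
      by (cases c) auto
    ultimately show "\<delta> ` E = {Red, Blue}"
      by blast
  next
    fix u v c assume uv: "{u, v} \<in> E" and reach: "(u, v) \<in> reachable {e \<in> E. \<delta> e = c}"
    show "\<delta> {u, v} = c"
    proof (cases c)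
      case Red
      then show ?thesis using red_path reach Red_iff by simp
    next
      case Blue
      then show ?thesis
        using blue_path[of u v u v] reach not_both[OF uv] Blue_iff by blast
    qed
  qed
  have inv: "\<forall>\<gamma>\<in>J. \<forall>e\<in>E. \<delta> (\<theta> \<gamma> ` e) = \<delta> e"
  proof (intro ballI)
    fix \<gamma> e assume \<gamma>: "\<gamma> \<in> J" and "e \<in> E"
    then obtain u v where e: "e = {u, v}" "u \<in> V" "v \<in> V"
      using edge_obtain[OF simple] by metis
    \<comment> \<open>The action scales a displacement by a nonzero constant, which does not affect
      membership in \<open>S\<close>.\<close>
    have "D (\<theta> \<gamma> u) (\<theta> \<gamma> v) = (\<lambda>t. rot k \<gamma> * D u v t)"
      using equiv[OF \<gamma>] e by (simp add: D_eq fun_eq_iff flip: right_diff_distrib)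
    then have "D (\<theta> \<gamma> u) (\<theta> \<gamma> v) \<in> S \<longleftrightarrow> D u v \<in> S"
      using S(4)[of "D u v" "rot k \<gamma>"] S_scaleD[of "rot k \<gamma>" "D u v"] by auto
    then have "\<delta> {\<theta> \<gamma> u, \<theta> \<gamma> v} = \<delta> {u, v}"
      using Red_iff[of u v] Red_iff[of "\<theta> \<gamma> u" "\<theta> \<gamma> v"] Blue_iff[of u v]
        Blue_iff[of "\<theta> \<gamma> u" "\<theta> \<gamma> v"] by metis
    then show "\<delta> (\<theta> \<gamma> ` e) = \<delta> e"
      using e by simp
  qed
  have rot_ne: "rot k \<gamma> - 1 \<noteq> 0" if "\<gamma> \<in> J" "\<gamma> \<noteq> 0" for \<gamma>
  proof -
    have "0 < \<gamma>" "\<gamma> < int k"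
      using that by auto
    then show ?thesis
      using rot_neq_1 by simp
  qed
  have invariant_reach: "\<exists>\<gamma>\<in>J. \<gamma> \<noteq> 0 \<and> (\<theta> \<gamma> u, u) \<in> reachable {e \<in> E. \<delta> e = c}"
    if H: "H \<in> color_components V E \<delta> c" "partially_invariant_component k \<theta> H" "u \<in> H" for H c u
  proof -
    obtain \<gamma> where \<gamma>: "\<gamma> \<in> J" "\<gamma> \<noteq> 0" "\<theta> \<gamma> ` H = H"
      using H(2) by (auto simp: partially_invariant_component_def carrier_cyclic)
    have "\<theta> \<gamma> u \<in> H"
      using imageI[OF H(3), of "\<theta> \<gamma>"] \<gamma>(3) by simp
    then have "(u, \<theta> \<gamma> u) \<in> reachable {e \<in> E. \<delta> e = c}"
      using color_component_eq[OF H(1,3)] by (simp add: component_def)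
    then have "(\<theta> \<gamma> u, u) \<in> reachable {e \<in> E. \<delta> e = c}"
      by (rule reachable_sym)
    then show ?thesis using \<gamma> by blast
  qed
  have "\<not> (\<exists>u\<in>H. \<exists>v\<in>H'. {u, v} \<in> E)"
    if H: "H \<in> color_components V E \<delta> c" "partially_invariant_component k \<theta> H"
      and H': "H' \<in> color_components V E \<delta> c" "partially_invariant_component k \<theta> H'"
      and neq: "H \<noteq> H'" for H H' c
  proof
    assume "\<exists>u\<in>H. \<exists>v\<in>H'. {u, v} \<in> E"
    then obtain u v where uv: "u \<in> H" "v \<in> H'" "{u, v} \<in> E" by blast
    obtain \<gamma> where \<gamma>: "\<gamma> \<in> J" "\<gamma> \<noteq> 0" "(\<theta> \<gamma> u, u) \<in> reachable {e \<in> E. \<delta> e = c}"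
      using invariant_reach[OF H uv(1)] by blast
    obtain \<gamma>' where \<gamma>': "\<gamma>' \<in> J" "\<gamma>' \<noteq> 0" "(\<theta> \<gamma>' v, v) \<in> reachable {e \<in> E. \<delta> e = c}"
      using invariant_reach[OF H' uv(2)] by blast
    have V: "u \<in> V" "v \<in> V"
      using edge_endpoints[OF simple uv(3)] by auto
    \<comment> \<open>An edge of color \<open>c\<close> would merge the two components. So it has
      the other color, which is refuted next.\<close>
    have "\<delta> {u, v} \<noteq> c"
    proof
      assume "\<delta> {u, v} = c"
      then have "(u, v) \<in> reachable {e \<in> E. \<delta> e = c}"
        using uv by (intro reachable_edge) simp
      then have "component \<delta> c u = component \<delta> c v"
        using component_eq_iff[OF V] by blast
      moreover have "H = component \<delta> c u"
        by (rule color_component_eq[OF H(1) uv(1)])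
      moreover have "H' = component \<delta> c v"
        by (rule color_component_eq[OF H'(1) uv(2)])
      ultimately show False using neq by simp
    qed
    show False
    proof (cases c)
      case Red
      \<comment> \<open>In a partially invariant red component the displacement from
        \<open>x\<close> to its image is a nonzero multiple of the position of \<open>x\<close>, so
        the position itself is small. Subtracting this for \<open>u\<close> and \<open>v\<close>
        makes \<open>D u v\<close> small and the edge red.\<close>
      have r_in: "r x \<in> S" if j: "j \<in> J" "j \<noteq> 0" and x: "x \<in> V" "(\<theta> j x, x) \<in> reachable {e \<in> E. \<delta> e = c}" for j x
      proof -
        have "D (\<theta> j x) x = (\<lambda>t. (rot k j - 1) * r x t)"
          using equiv[OF j(1) x(1)] by (simp add: D_eq r_def fun_eq_iff left_diff_distrib)
        then have "(\<lambda>t. (rot k j - 1) * r x t) \<in> S"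
          using red_path[of "\<theta> j x" x] x(2) Red by simp
        then show ?thesis
          using S_scaleD[of "rot k j - 1" "r x"] rot_ne[OF j] by blast
      qed
      have "(\<lambda>t. r u t + - 1 * r v t) \<in> S"
        by (rule S(3)[OF r_in[OF \<gamma>(1,2) V(1) \<gamma>(3)] S(4)[OF r_in[OF \<gamma>'(1,2) V(2) \<gamma>'(3)]]])
      moreover have "(\<lambda>t. r u t + - 1 * r v t) = D u v"
        by (simp add: D_def fun_eq_iff)
      ultimately have "D u v \<in> S"
        by simp
      then show False
        using \<open>\<delta> {u, v} \<noteq> c\<close> Red Red_iff by simp
    next
      case Blue
      then have red: "D u v \<in> S"
        using \<open>\<delta> {u, v} \<noteq> c\<close> Blue_iff by blast
      \<comment> \<open>The conjugate analogue, with the red edge \<open>{u, v}\<close> as the small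
        factor. The difference of the cases \<open>x = u\<close> and \<open>x = v\<close> is the
        squared length of that edge, which is not in \<open>S\<close>.\<close>
      have cnj_in: "(\<lambda>t. cnj (w x t) * (w u t - w v t)) \<in> S"
        if j: "j \<in> J" "j \<noteq> 0" and x: "x \<in> V" "(\<theta> j x, x) \<in> reachable {e \<in> E. \<delta> e = c}" for j x
      proof -
        let ?z = "cnj (rot k j - 1)" and ?f = "\<lambda>t. cnj (w x t) * (w u t - w v t)"
        have "(\<lambda>t. cnj (w (\<theta> j x) t - w x t) * (w u t - w v t)) = (\<lambda>t. ?z * ?f t)"
          using equiv[OF j(1) x(1)] by (simp add: algebra_simps)
        moreover have "(\<theta> j x, x) \<in> reachable {e \<in> E. \<delta> e = Blue}"
          using x(2) Blue by simp
        ultimately have "(\<lambda>t. ?z * ?f t) \<in> S"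
          using blue_path[of "\<theta> j x" x, OF _ red] by metis
        moreover have "?z \<noteq> 0"
          using rot_ne[OF j] by (metis complex_cnj_zero_iff)
        ultimately show ?thesis
          using S_scaleD[of ?z ?f] by blast
      qed
      have "(\<lambda>t. cnj (w u t) * (w u t - w v t) + - 1 * (cnj (w v t) * (w u t - w v t))) \<in> S"
        by (rule S(3)[OF cnj_in[OF \<gamma>(1,2) V(1) \<gamma>(3)] S(4)[OF cnj_in[OF \<gamma>'(1,2) V(2) \<gamma>'(3)]]])
      moreover have "cnj (w u t) * (w u t - w v t) + - 1 * (cnj (w v t) * (w u t - w v t))
          = cnj (w u t - w v t) * (w u t - w v t)" for t
        by (simp add: algebra_simps)
      ultimately show False
        using not_both[OF uv(3)] by simp
    qed
  qed
  then have "symmetric_NAC_coloring k \<theta> V E \<delta>"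
    unfolding symmetric_NAC_coloring_def carrier_cyclic using NAC inv by blast
  then show ?thesis
    by (rule exI[of _ \<delta>])
qed

end


section \<open>From a coloring to a motion, and the equivalence\<close>

context symmetric_action
begin

text \<open>Label the components of color \<open>c\<close> equivariantly. Equal labels at the ends
  of an edge mean either one component, so the edge has color \<open>c\<close> by the NAC property,
  or two distinct partially invariant ones, which no edge joins.\<close>

lemma ex_equivariant_component_labelling:
  assumes \<delta>: "symmetric_NAC_coloring k \<theta> V E \<delta>" and count: "countable V"
  shows "\<exists>a :: 'v \<Rightarrow> complex. (\<forall>j\<in>J. \<forall>v\<in>V. a (\<theta> j v) = rot k j * a v) \<and>
    (\<forall>u v. {u, v} \<in> E \<longrightarrow> (a u = a v \<longleftrightarrow> \<delta> {u, v} = c))"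
proof -
  have NAC: "NAC_coloring E \<delta>" and inv: "\<forall>\<gamma>\<in>J. \<forall>e\<in>E. \<delta> (\<theta> \<gamma> ` e) = \<delta> e"
    and sep: "\<And>H H'. H \<in> color_components V E \<delta> c \<Longrightarrow> H' \<in> color_components V E \<delta> c \<Longrightarrow> H \<noteq> H' \<Longrightarrow>
      partially_invariant_component k \<theta> H \<Longrightarrow> partially_invariant_component k \<theta> H' \<Longrightarrow>
      \<not> (\<exists>u\<in>H. \<exists>v\<in>H'. {u, v} \<in> E)"
    using \<delta> unfolding symmetric_NAC_coloring_def carrier_cyclic by blast+
  let ?X = "color_components V E \<delta> c"
  have sub: "H \<subseteq> V" if "H \<in> ?X" for H
    using that component_subset by (auto simp: color_components_eq)
  have "\<exists>f :: 'v set \<Rightarrow> complex. (\<forall>j\<in>J. \<forall>H\<in>?X. f (\<theta> j ` H) = rot k j * f H) \<and>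
           (\<forall>H\<in>?X. \<forall>H'\<in>?X. f H = f H' \<longrightarrow> H = H' \<or>
              (\<exists>j\<in>J. j \<noteq> 0 \<and> \<theta> j ` H = H) \<and> (\<exists>j\<in>J. j \<noteq> 0 \<and> \<theta> j ` H' = H'))"
  proof (rule equivariant_labelling)
    show "0 < k" using k2 by simp
    show "countable ?X"
      using count by (simp add: color_components_eq)
    show "\<theta> j ` H \<in> ?X" if "j \<in> J" "H \<in> ?X" for j H
      using that component_action[OF inv] action_closed by (auto simp: color_components_eq)
    show "\<theta> 0 ` H = H" if "H \<in> ?X" for H
      using sub[OF that] action_zero by (auto simp: subset_iff image_iff)
    show "\<theta> ((i + j) mod int k) ` H = \<theta> i ` \<theta> j ` H" if "i \<in> J" "j \<in> J" "H \<in> ?X" for i j H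
      unfolding image_image using sub[OF that(3)] action_add that by (intro image_cong) auto
  qed
  then obtain f :: "'v set \<Rightarrow> complex" where
      f: "\<forall>j\<in>J. \<forall>H\<in>?X. f (\<theta> j ` H) = rot k j * f H"
    and f_inj: "\<forall>H\<in>?X. \<forall>H'\<in>?X. f H = f H' \<longrightarrow> H = H' \<or>
        (\<exists>j\<in>J. j \<noteq> 0 \<and> \<theta> j ` H = H) \<and> (\<exists>j\<in>J. j \<noteq> 0 \<and> \<theta> j ` H' = H')"
    by (elim exE conjE)
  define a where "a v = f (component \<delta> c v)" for v
  have X: "component \<delta> c v \<in> ?X" if "v \<in> V" for v
    using that by (simp add: color_components_eq)
  have "a (\<theta> j v) = rot k j * a v" if "j \<in> J" "v \<in> V" for j v
    using f[rule_format, OF that(1) X[OF that(2)]] component_action[OF inv that] by (simp add: a_def)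
  moreover have "a u = a v \<longleftrightarrow> \<delta> {u, v} = c" if uv: "{u, v} \<in> E" for u v
  proof
    have V: "u \<in> V" "v \<in> V"
      using edge_endpoints[OF simple uv] by auto
    show "a u = a v" if "\<delta> {u, v} = c"
    proof -
      have "(u, v) \<in> reachable {e \<in> E. \<delta> e = c}"
        using uv that by (intro reachable_edge) simp
      then have "component \<delta> c u = component \<delta> c v"
        using component_eq_iff[OF V] by blast
      then show ?thesis
        by (simp add: a_def)
    qed
    show "\<delta> {u, v} = c" if eq: "a u = a v"
    proof (rule ccontr)
      assume "\<delta> {u, v} \<noteq> c"
      then have "component \<delta> c u \<noteq> component \<delta> c v"
        using NAC_coloring_reachable[OF simple NAC uv, of c] component_eq_iff[OF V, of \<delta> c] by blast
      moreover from this have "partially_invariant_component k \<theta> (component \<delta> c u)"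
          "partially_invariant_component k \<theta> (component \<delta> c v)"
        using f_inj[rule_format, OF X[OF V(1)] X[OF V(2)]] eq
        by (simp_all add: a_def partially_invariant_component_def carrier_cyclic)
      ultimately show False
        using sep[OF X[OF V(1)] X[OF V(2)]] uv component_self V by blast
    qed
  qed
  ultimately show ?thesis
    by (intro exI[of _ a]) simp
qed

end

text \<open>Otherwise incidence with a red edge spreads along a path from an end of a red edge to an
  end of a blue one.\<close>

lemma ex_bichromatic_vertex:
  assumes G: "simple_graph V E" and conn: "connected_graph V E" and surj: "\<delta> ` E = {Red, Blue}"
  shows "\<exists>z x y. {z, x} \<in> E \<and> \<delta> {z, x} = Red \<and> {z, y} \<in> E \<and> \<delta> {z, y} = Blue"
proof (rule ccontr)
  assume none: "\<not> ?thesis"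
  obtain e e' where e: "e \<in> E" "\<delta> e = Red" "e' \<in> E" "\<delta> e' = Blue"
    using surj by (metis imageE insertI1 insertI2)
  obtain p q where pq: "e = {p, q}" "p \<in> V"
    using edge_obtain[OF G e(1)] by metis
  obtain r s where rs: "e' = {r, s}" "r \<in> V"
    using edge_obtain[OF G e(3)] by metis
  have "(p, r) \<in> reachable E"
    using conn pq rs by (simp add: connected_graph_def)
  then have "\<exists>x. {r, x} \<in> E \<and> \<delta> {r, x} = Red"
  proof (induction rule: reachable_induct)
    case refl
    then show ?case using e pq by blast
  next
    case (step x y)
    then have "\<delta> {x, y} \<noteq> Blue"
      using none by blast
    then have "\<delta> {y, x} = Red"
      using color.exhaust[of "\<delta> {x, y}" "\<delta> {x, y} = Red"] by (simp add: insert_commute)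
    then show ?case
      using step.hyps by (auto simp: insert_commute)
  qed
  then show False
    using none rs e by blast
qed

text \<open>Three points on a circle cannot have the same real part.\<close>

lemma rotations_same_Re:
  assumes "norm z = 1" "z \<noteq> 1" "z\<^sup>2 \<noteq> 1" "Re (z * d) = Re d" "Re (z\<^sup>2 * d) = Re d"
  shows "d = 0"
proof (rule ccontr)
  assume d: "d \<noteq> 0"
  have eq_or_cnj: "x = y \<or> x = cnj y" if "norm x = norm y" "Re x = Re y" for x y :: complex
  proof -
    have "(Im x)\<^sup>2 = (Im y)\<^sup>2"
      using that cmod_power2[of x] cmod_power2[of y] by simp
    then show ?thesis
      using that(2) by (auto simp: complex_eq_iff power2_eq_iff)
  qed
  have "norm (z * d) = norm d" "norm (z\<^sup>2 * d) = norm d"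
    using assms(1) by (simp_all add: norm_mult norm_power)
  then have "z * d = d \<or> z * d = cnj d" "z\<^sup>2 * d = d \<or> z\<^sup>2 * d = cnj d"
    using eq_or_cnj assms by blast+
  \<comment> \<open>Neither \<open>z\<close> nor its square is \<open>1\<close>, so both points are
    the mirror image of \<open>d\<close> and hence coincide.\<close>
  then have "z * d = cnj d" "z\<^sup>2 * d = cnj d"
    using assms(2,3) d by auto
  then have "z\<^sup>2 * d = z * d"
    by simp
  then show False
    using assms(1,2) d by (auto simp: power2_eq_square)
qed

context symmetric_action
begin

text \<open>Red edges keep their displacement, the difference of \<open>b\<close>; blue edges have
  the difference of \<open>a\<close> as displacement, turned by \<open>cis t\<close>. At a vertex
  with edges of both colors the angle changes, so the flex is not trivial.\<close>

lemma flexible_of_symmetric_NAC_coloring: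
  assumes conn: "connected_graph V E" and count: "countable V"
    and \<delta>: "symmetric_NAC_coloring k \<theta> V E \<delta>"
  shows "\<exists>\<rho>. symmetric_realization k \<theta> V E \<rho> \<and> symmetric_flexible k \<theta> V E \<rho>"
proof -
  obtain a :: "'v \<Rightarrow> complex" where a_act: "\<And>j v. j \<in> J \<Longrightarrow> v \<in> V \<Longrightarrow> a (\<theta> j v) = rot k j * a v"
    and a_edge: "\<And>u v. {u, v} \<in> E \<Longrightarrow> a u = a v \<longleftrightarrow> \<delta> {u, v} = Red"
    using ex_equivariant_component_labelling[OF \<delta> count, of Red] by blast
  obtain b :: "'v \<Rightarrow> complex" where b_act: "\<And>j v. j \<in> J \<Longrightarrow> v \<in> V \<Longrightarrow> b (\<theta> j v) = rot k j * b v"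
    and b_edge: "\<And>u v. {u, v} \<in> E \<Longrightarrow> b u = b v \<longleftrightarrow> \<delta> {u, v} = Blue"
    using ex_equivariant_component_labelling[OF \<delta> count, of Blue] by blast
  define w where "w t v = cis t * a v + b v" for t v
  define \<rho> where "\<rho> t v = of_complex (w t v)" for t v
  have edge: "w t u \<noteq> w t v \<and> dist (w t u) (w t v) = dist (w 0 u) (w 0 v)" if "{u, v} \<in> E" for t u v
  proof (cases "\<delta> {u, v}")
    case Red
    then have "a u = a v" "b u \<noteq> b v"
      using a_edge[OF that] b_edge[OF that] by auto
    then show ?thesis
      by (simp add: w_def)
  next
    case Blue
    then have "a u \<noteq> a v" "b u = b v"
      using a_edge[OF that] b_edge[OF that] by auto
    moreover have "cmod (cis t * a u - cis t * a v) = cmod (a u - a v)"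
      by (simp add: norm_mult flip: right_diff_distrib)
    ultimately show ?thesis
      by (simp add: w_def dist_norm)
  qed
  have sym: "symmetric_realization k \<theta> V E (\<rho> t)" for t
  proof -
    have "\<rho> t (\<theta> j v) = rotate_clockwise (2 * real_of_int j * pi / real k) (\<rho> t v)"
      if "j \<in> J" "v \<in> V" for j v
      using a_act[OF that] b_act[OF that]
      by (simp add: \<rho>_def rotate_clockwise_of_complex w_def rot_def algebra_simps)
    then show ?thesis
      using edge by (simp add: symmetric_realization_def carrier_cyclic realization_def \<rho>_def)
  qed
  have flex: "is_flex V E (\<rho> 0) 1 \<rho>"
    unfolding is_flex_def
  proof (intro conjI ballI allI impI)
    show "continuous_on {0..<1} (\<lambda>t. \<rho> t v)" for v
      unfolding \<rho>_def w_def by (intro continuous_on_of_complex continuous_intros)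
    show "realization E (\<rho> t)" for t
      using sym[of t] by (simp add: symmetric_realization_def)
    show "dist (\<rho> t u) (\<rho> t v) = dist (\<rho> 0 u) (\<rho> 0 v)" if "{u, v} \<in> E" for t u v
      unfolding \<rho>_def dist_of_complex using edge[OF that] by (rule conjunct2)
  qed simp_all
  have "\<not> trivial_flex V (\<rho> 0) 1 \<rho>"
  proof
    assume trivial: "trivial_flex V (\<rho> 0) 1 \<rho>"
    have dist_eq: "dist (w t x) (w t y) = dist (w 0 x) (w 0 y)" if t: "t \<in> {0..<1}" and xy: "x \<in> V" "y \<in> V" for t x y
    proof -
      have "congruent_realizations V (\<rho> 0) (\<rho> t)"
        using trivial t by (simp add: trivial_flex_def)
      then obtain f where "\<forall>x y. dist (f x) (f y) = dist x y" "\<forall>v\<in>V. \<rho> t v = f (\<rho> 0 v)"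
        unfolding congruent_realizations_def by (elim exE conjE)
      then have "dist (\<rho> t x) (\<rho> t y) = dist (\<rho> 0 x) (\<rho> 0 y)"
        using xy by simp
      then show ?thesis
        by (simp add: \<rho>_def)
    qed
    have surj: "\<delta> ` E = {Red, Blue}"
      using \<delta> by (simp add: symmetric_NAC_coloring_def NAC_coloring_def)
    obtain z x y where zxy: "{z, x} \<in> E" "\<delta> {z, x} = Red" "{z, y} \<in> E" "\<delta> {z, y} = Blue"
      using ex_bichromatic_vertex[OF simple conn surj] by blast
    \<comment> \<open>The displacement between the outer ends of a red and a blue edge at
      \<open>z\<close> is \<open>cis t * A + B\<close>, and both coefficients are nonzero.\<close>
    define A where "A = a x - a y"
    define B where "B = b x - b y"
    have "a x = a z" "a y \<noteq> a z" "b y = b z" "b x \<noteq> b z"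
      using a_edge[OF zxy(1)] a_edge[OF zxy(3)] b_edge[OF zxy(1)] b_edge[OF zxy(3)] zxy by auto
    then have AB: "A \<noteq> 0" "B \<noteq> 0"
      by (auto simp: A_def B_def)
    have V: "x \<in> V" "y \<in> V"
      using edge_endpoints[OF simple zxy(1)] edge_endpoints[OF simple zxy(3)] by auto
    \<comment> \<open>Expanding the squared norm of \<open>cis t * A + B\<close>, only the mixed
      term depends on \<open>t\<close>.\<close>
    have Re_eq: "Re (cis t * (A * cnj B)) = Re (A * cnj B)" if t: "t \<in> {0..<1}" for t
    proof -
      have w_diff: "w s x - w s y = cis s * A + B" for s
        by (simp add: w_def A_def B_def algebra_simps)
      have "cmod (cis t * A + B) = cmod (cis 0 * A + B)"
        using dist_eq[OF t V] unfolding dist_norm w_diff .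
      then have "(cmod (cis t * A + B))\<^sup>2 = (cmod (A + B))\<^sup>2"
        by simp
      moreover have "(cmod (u + B))\<^sup>2 = (cmod u)\<^sup>2 + (cmod B)\<^sup>2 + 2 * Re (u * cnj B)" for u
        unfolding cmod_power2 by (simp add: power2_eq_square algebra_simps)
      moreover have "cmod (cis t * A) = cmod A"
        by (simp add: norm_mult)
      ultimately show ?thesis
        by (simp add: mult.assoc)
    qed
    have cis_neq: "cis t \<noteq> 1" if "0 < t" "t < 1" for t
    proof
      assume "cis t = 1"
      then have "sin t = 0"
        by (simp add: complex_eq_iff)
      then show False
        using sin_gt_zero[of t] that pi_gt3 by simp
    qed
    \<comment> \<open>The times \<open>0\<close>, \<open>1/4\<close> and \<open>1/2\<close> lie in
      the parameter interval and below \<open>pi\<close>, which gives the three points on a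
      circle.\<close>
    have "A * cnj B = 0"
    proof (rule rotations_same_Re)
      have sq: "(cis (1/4))\<^sup>2 = cis (1/2)"
        by (simp add: power2_eq_square cis_mult)
      show "cis (1/4) \<noteq> 1" "(cis (1/4))\<^sup>2 \<noteq> 1"
        unfolding sq by (intro cis_neq; simp)+
      show "Re (cis (1/4) * (A * cnj B)) = Re (A * cnj B)"
        by (rule Re_eq) simp
      show "Re ((cis (1/4))\<^sup>2 * (A * cnj B)) = Re (A * cnj B)"
        unfolding sq by (rule Re_eq) simp
    qed simp
    then show False
      using AB by simp
  qed
  then have "symmetric_flexible k \<theta> V E (\<rho> 0)"
    unfolding symmetric_flexible_def using flex sym by blast
  then show ?thesis
    using sym by blast
qed

text \<open>If all ratios of edge displacements to a reference edge were constant, the whole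
  framework would move rigidly. So some ratio varies, and by continuity it takes infinitely many
  values.\<close>

lemma symmetric_NAC_coloring_of_flexible:
  assumes conn: "connected_graph V E" and inf: "infinite V"
    and flexible: "symmetric_flexible k \<theta> V E \<rho>"
  shows "\<exists>\<delta>. symmetric_NAC_coloring k \<theta> V E \<delta>"
proof -
  obtain \<epsilon> \<rho>t where flex: "is_flex V E \<rho> \<epsilon> \<rho>t" and nontrivial: "\<not> trivial_flex V \<rho> \<epsilon> \<rho>t"
    and sym: "\<And>t. t \<in> {0..<\<epsilon>} \<Longrightarrow> symmetric_realization k \<theta> V E (\<rho>t t)"
    using flexible unfolding symmetric_flexible_def by blast
  let ?I = "{0..<\<epsilon>}"
  have \<epsilon>: "0 \<in> ?I"
    using flex by (simp add: is_flex_def)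
  \<comment> \<open>Times outside the interval are sent to \<open>0\<close>, so that the motion is
    defined on all reals and still consists of positions of the flex.\<close>
  define s where "s t = (if t \<in> ?I then t else 0)" for t
  have s: "s t \<in> ?I" for t
    using \<epsilon> by (simp add: s_def)
  define w where "w v t = to_complex (\<rho>t (s t) v)" for v t
  have distinct: "w u t \<noteq> w v t" if "{u, v} \<in> E" for u v t
    using flex s[of t] that by (simp add: is_flex_def realization_def w_def)
  have len: "cmod (w u t - w v t) = dist (\<rho> u) (\<rho> v)" if "{u, v} \<in> E" for u v t
    using flex s[of t] that by (simp add: is_flex_def w_def flip: dist_norm)
  have equiv: "w (\<theta> j v) t = rot k j * w v t" if "j \<in> J" "v \<in> V" for j v t
    using sym[OF s] that
    by (simp add: symmetric_realization_def carrier_cyclic w_def to_complex_rotate_clockwise rot_def)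
  have cont: "continuous_on ?I (w v)" if "v \<in> V" for v
  proof -
    have "continuous_on ?I (\<lambda>t. to_complex (\<rho>t t v))"
      using flex that by (intro continuous_on_to_complex) (simp add: is_flex_def)
    then show ?thesis
      by (rule continuous_on_eq) (simp add: w_def s_def)
  qed
  obtain p q where "p \<in> V" "q \<in> V" "p \<noteq> q"
    using inf by (metis finite.emptyI finite_insert finite_subset insert_iff subsetI)
  then obtain u0 v0 where e0: "{u0, v0} \<in> E"
    using conn unfolding connected_graph_def reachable_def
    by (metis (no_types, lifting) case_prodD converse_rtranclE mem_Collect_eq)
  define q where "q u v t = (w u t - w v t) / (w u0 t - w v0 t)" for u v t
  have u0V: "u0 \<in> V" "v0 \<in> V"
    using edge_endpoints[OF simple e0] by auto
  have "\<exists>u v. {u, v} \<in> E \<and> (\<exists>t\<in>?I. q u v t \<noteq> q u v 0)"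
  proof (rule ccontr)
    assume "\<not> ?thesis"
    then have const: "\<And>u v t. {u, v} \<in> E \<Longrightarrow> t \<in> ?I \<Longrightarrow> q u v t = q u v 0"
      by blast
    have "trivial_flex V \<rho> \<epsilon> \<rho>t"
      unfolding trivial_flex_def
    proof
      fix t assume t: "t \<in> ?I"
      have s0: "s 0 = 0" "s t = t"
        using \<epsilon> t by (simp_all add: s_def)
      let ?W = "\<lambda>t. w u0 t - w v0 t"
      have nz: "?W t \<noteq> 0" for t
        using distinct[OF e0] by simp
      \<comment> \<open>Displacements from \<open>u0\<close> are sums of edge displacements along a
        path, so their ratios are constant too.\<close>
      have q_const: "q v u0 t = q v u0 0" if "v \<in> V" for v
      proof -
        have "(u0, v) \<in> reachable E"
          using conn u0V that by (simp add: connected_graph_def)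
        then show ?thesis
        proof (induction rule: reachable_induct)
          case refl
          then show ?case by (simp add: q_def)
        next
          case (step x y)
          have "q y u0 t = q x u0 t - q x y t" for t
            by (simp add: q_def flip: diff_divide_distrib)
          then show ?case
            using step const[OF _ t] by simp
        qed
      qed
      \<comment> \<open>The rotation that turns the reference edge from its direction at time
        \<open>0\<close> to that at time \<open>t\<close>; with the shift of \<open>u0\<close> it
        yields the isometry \<open>f\<close>.\<close>
      define c where "c = ?W t / ?W 0"
      have "cmod c = 1"
      proof -
        have "cmod (?W t) = cmod (?W 0)" "cmod (?W 0) \<noteq> 0"
          using len[OF e0, of t] len[OF e0, of 0] nz[of 0] by (metis norm_eq_zero)+
        then show ?thesis
          by (simp add: c_def norm_divide)
      qed
      define f where "f p = of_complex (w u0 t + c * (to_complex p - w u0 0))" for p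
      have "dist (f x) (f y) = dist x y" for x y
      proof -
        have "dist (f x) (f y) = dist (w u0 t + c * (to_complex x - w u0 0)) (w u0 t + c * (to_complex y - w u0 0))"
          by (simp only: f_def dist_of_complex)
        also have "\<dots> = cmod (c * (to_complex x - to_complex y))"
          by (simp add: dist_norm algebra_simps)
        also have "\<dots> = dist (to_complex x) (to_complex y)"
          using \<open>cmod c = 1\<close> unfolding dist_norm norm_mult by simp
        finally show ?thesis
          unfolding dist_to_complex .
      qed
      moreover have "\<rho>t t v = f (\<rho> v)" if "v \<in> V" for v
      proof -
        have "to_complex (\<rho> v) = w v 0"
          using flex that s0 by (simp add: is_flex_def w_def)
        moreover have "w v t - w u0 t = c * (w v 0 - w u0 0)"
          using q_const[OF that] nz[of t] nz[of 0] by (simp add: q_def c_def field_simps)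
        ultimately have "f (\<rho> v) = of_complex (w v t)"
          by (simp add: f_def flip: \<open>w v t - w u0 t = c * (w v 0 - w u0 0)\<close>)
        then show ?thesis
          using s0 by (simp add: w_def)
      qed
      ultimately show "congruent_realizations V \<rho> (\<rho>t t)"
        unfolding congruent_realizations_def by blast
    qed
    then show False
      using nontrivial by contradiction
  qed
  then obtain u1 v1 t1 where e1: "{u1, v1} \<in> E" and t1: "t1 \<in> ?I" "q u1 v1 t1 \<noteq> q u1 v1 0"
    by blast
  have u1V: "u1 \<in> V" "v1 \<in> V"
    using edge_endpoints[OF simple e1] by auto
  have "continuous_on ?I (q u1 v1)"
    unfolding q_def using distinct[OF e0] by (intro continuous_intros cont u0V u1V) simp
  then have "connected (q u1 v1 ` ?I)"
    by (intro connected_continuous_image) auto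
  \<comment> \<open>A nonempty finite connected set is a single point.\<close>
  moreover have "\<not> (\<exists>z. q u1 v1 ` ?I = {z})"
    using t1 \<epsilon> by (metis imageI singletonD)
  ultimately have "infinite (q u1 v1 ` ?I)"
    using connected_finite_iff_sing \<epsilon> by blast
  then have "infinite (range (q u1 v1))"
    by (rule infinite_super[rotated]) auto
  then have "infinite (range (\<lambda>t. (w u1 t - w v1 t) / (w u0 t - w v0 t)))"
    by (simp add: q_def[abs_def])
  from symmetric_NAC_coloring_of_motion[OF distinct len equiv e0 e1 this] show ?thesis
    by blast
qed

end

theorem theorem6p9:
  fixes k :: nat
    and V :: "'v set"
    and E :: "'v set set"
    and \<theta> :: "int \<Rightarrow> 'v \<Rightarrow> 'v"
  assumes "2 \<le> k"
    and "symmetric_graph k \<theta> V E"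
    and "connected_graph V E"
    and "countable V"
    and "infinite V"
  shows "(\<exists>\<delta>. symmetric_NAC_coloring k \<theta> V E \<delta>) \<longleftrightarrow>
         (\<exists>\<rho>. symmetric_realization k \<theta> V E \<rho> \<and> symmetric_flexible k \<theta> V E \<rho>)"
proof -
  interpret symmetric_action k \<theta> V E
    using assms by unfold_locales
  show ?thesis
    using flexible_of_symmetric_NAC_coloring[OF assms(3,4)]
      symmetric_NAC_coloring_of_flexible[OF assms(3,5)] by blast
qed

end
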